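(* Let $B\le\mathrm{poly}(n)$ be an a priori upper bound on the multiplicity of every edge in the final graph. There is an online scheme for \textsc{MaxMatching} on strict turnstile graph streams over $n$ vertices (with multiplicities bounded by $B$) with total cost (help cost plus space cost) $O(B\cdot n\log n)$ bits and error at most $1/3$.
   Context: Strict turnstile graph streams: a stream is $\langle (e_1,\Delta_1),\dots,(e_m,\Delta_m)\rangle$ with each $e_i$ an undirected pair of vertices from $[n]$ and $\Delta_i\in\mathbb Z$; update $i$ adds $\Delta_i$ to the multiplicity of $e_i$. Final multiplicities are assumed nonnegative (intermediate ones may be negative) and at most $B$; the final graph $G$ has an edge $\{u,v\}$ iff its final multiplicity is positive. \textsc{MaxMatching}: output the size of a maximum matching of $G$. Annotated data streams: for a function $F$ of a stream $\mathbf x\in\mathcal U^m$, a scheme is a pair $(\mathfrak h,V)$ where $\mathfrak h_i:\mathcal U^m\to\{0,1\}^*$ is the prover's annotation inserted after token $x_i$, and $V$ is a single-pass streaming algorithm with a private random string reading the annotated stream and outputting a value or $\bot$. Online: $\mathfrak h_i$ depends only on $x_1,\dots,x_i$. Completeness: with the honest annotation, $V$ outputs $F(\mathbf x)$ except with probability $\le\delta_c$. Soundness: for every annotation, $V$ outputs a value outside $\{F(\mathbf x),\bot\}$ with probability $\le\delta_s$. Error $=\max(\delta_s,\delta_c)$. Help cost $=\max_{\mathbf x}\sum_i|\mathfrak h_i(\mathbf x)|$; space cost = bits of memory used by $V$. *)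

theory Defs
  imports "HOL-Probability.Probability"
begin

text \<open>A stream token is a pair (e, Delta): e an undirected vertex pair (a 2-element set),
  Delta an integer multiplicity change.\<close>
type_synonym token = "nat set \<times> int"

definition valid_edge :: "nat \<Rightarrow> nat set \<Rightarrow> bool" where
  "valid_edge n e \<longleftrightarrow> (\<exists>u v. u < n \<and> v < n \<and> u \<noteq> v \<and> e = {u, v})"

definition mult :: "token list \<Rightarrow> nat set \<Rightarrow> int" where
  "mult xs e = sum_list (map snd (filter (\<lambda>t. fst t = e) xs))"

definition strict_turnstile :: "nat \<Rightarrow> nat \<Rightarrow> token list \<Rightarrow> bool" where
  "strict_turnstile n B xs \<longleftrightarrow>
     (\<forall>t\<in>set xs. valid_edge n (fst t)) \<and> (\<forall>e. 0 \<le> mult xs e \<and> mult xs e \<le> int B)"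

definition final_edges :: "token list \<Rightarrow> nat set set" where
  "final_edges xs = {e. mult xs e > 0}"

definition is_matching :: "nat set set \<Rightarrow> nat set set \<Rightarrow> bool" where
  "is_matching E M \<longleftrightarrow> M \<subseteq> E \<and> (\<forall>e\<in>M. \<forall>f\<in>M. e \<noteq> f \<longrightarrow> e \<inter> f = {})"

definition max_matching :: "token list \<Rightarrow> nat" where
  "max_matching xs = Max {card M | M. is_matching (final_edges xs) M}"

datatype sym = Tok token | Bit bool

definition annotate :: "token list \<Rightarrow> bool list list \<Rightarrow> sym list" where
  "annotate xs a = concat (map (\<lambda>(t, w). Tok t # map Bit w) (zip xs a))"

text \<open>Online honest prover: the annotation after x_i is a function of the prefix x_1..x_i.\<close>
definition honest :: "(token list \<Rightarrow> bool list) \<Rightarrow> token list \<Rightarrow> bool list list" where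
  "honest h xs = map (\<lambda>i. h (take (Suc i) xs)) [0..<length xs]"

text \<open>Randomised single-pass verifier: memory is a bit string; random initial memory
  (private random string) and randomised transitions on each symbol.\<close>
definition run :: "bool list pmf \<Rightarrow> (bool list \<Rightarrow> sym \<Rightarrow> bool list pmf) \<Rightarrow> sym list \<Rightarrow> bool list pmf" where
  "run init step ss = foldl (\<lambda>p s. bind_pmf p (\<lambda>q. step q s)) init ss"

definition space_bounded :: "nat \<Rightarrow> bool list pmf \<Rightarrow> (bool list \<Rightarrow> sym \<Rightarrow> bool list pmf) \<Rightarrow> bool" where
  "space_bounded S init step \<longleftrightarrow>
     (\<forall>q\<in>set_pmf init. length q \<le> S) \<and>
     (\<forall>q s. length q \<le> S \<longrightarrow> (\<forall>q'\<in>set_pmf (step q s). length q' \<le> S))"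

text \<open>Output distribution of verifier (None = reject, i.e. bottom).\<close>
definition verdict :: "bool list pmf \<Rightarrow> (bool list \<Rightarrow> sym \<Rightarrow> bool list pmf) \<Rightarrow> (bool list \<Rightarrow> nat option)
    \<Rightarrow> sym list \<Rightarrow> nat option pmf" where
  "verdict init step out ss = map_pmf out (run init step ss)"

definition online_maxmatching_scheme ::
  "nat \<Rightarrow> nat \<Rightarrow> nat \<Rightarrow> (token list \<Rightarrow> bool list) \<Rightarrow> bool list pmf
    \<Rightarrow> (bool list \<Rightarrow> sym \<Rightarrow> bool list pmf) \<Rightarrow> (bool list \<Rightarrow> nat option)
    \<Rightarrow> nat \<Rightarrow> nat \<Rightarrow> real \<Rightarrow> bool" where
  "online_maxmatching_scheme n B m h init step out H S eps \<longleftrightarrow>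
     space_bounded S init step \<and>
     (\<forall>xs. length xs = m \<and> strict_turnstile n B xs \<longrightarrow>
        sum_list (map length (honest h xs)) \<le> H \<and>
        measure_pmf.prob (verdict init step out (annotate xs (honest h xs)))
          {r. r \<noteq> Some (max_matching xs)} \<le> eps \<and>
        (\<forall>a. length a = m \<longrightarrow>
           measure_pmf.prob (verdict init step out (annotate xs a))
             {r. r \<notin> {Some (max_matching xs), None}} \<le> eps))"

end

theory Submission
  imports Defs "HOL-Computational_Algebra.Primes"
begin

text \<open>By the Tutte--Berge formula, the size of a maximum matching is certified by a matching \<open>M\<close>, a barrier
  \<open>U\<close> and a partition of the remaining vertices such that no edge joins distinct parts and
  \<open>card M = card U + (\<Sum>i. card (part i) div 2)\<close>. After the last token the prover sends such a certificate with two
  univariate polynomials \<open>f\<^sub>1\<close>, \<open>f\<^sub>2\<close> of degree less than \<open>2n\<close> modulo a prime \<open>p\<close> that is polynomial in \<open>n\<close>. Up to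
  a factor prime to \<open>p\<close>, the value \<open>f\<^sub>1(u)\<close> is the total multiplicity of the edges at \<open>u\<close> that join distinct
  parts, and \<open>f\<^sub>2(u)\<close> is the multiplicity of the edge of \<open>M\<close> at \<open>u\<close>. Multiplicities are nonnegative and
  \<open>n * B < p\<close>, so these values modulo \<open>p\<close> decide whether the certificate is valid. During the stream the
  verifier maintains, for every vertex \<open>v\<close>, the value at a secret random point \<open>r\<close> of the polynomial interpolating
  column \<open>v\<close> of the adjacency matrix; from these values it computes \<open>f\<^sub>1(r)\<close> and \<open>f\<^sub>2(r)\<close> itself, and a false
  polynomial agrees with the true one at fewer than \<open>2n \<le> p / 3\<close> points.\<close>

section \<open>Primes of polynomial size\<close>

text \<open>The reciprocals of \<open>(n+1) * (n choose m)\<close> form Leibniz's harmonic triangle.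
  Each entry is the entry above it minus its left neighbour, so induction on the column index
  \<open>m\<close> shows that the least common multiple clears all denominators.\<close>

lemma Lcm_div_leibniz_in_Ints:
  fixes n m :: nat
  assumes "m \<le> n"
  shows "real (Lcm {1..n+1}) / (real (n+1) * real (n choose m)) \<in> \<int>"
  using assms
proof (induction m arbitrary: n)
  case 0
  have "n + 1 dvd Lcm {1..n+1}" by (intro dvd_Lcm) auto
  then obtain k where "Lcm {1..n+1} = (n + 1) * k" by (elim dvdE)
  then have "real (Lcm {1..n+1}) = (1 + real n) * real k"
    by (metis Suc_eq_plus1 of_nat_Suc of_nat_mult)
  then have "real (Lcm {1..n+1}) / (real (n+1) * real (n choose 0)) = real k" by simp
  then show ?case by simp
next
  case (Suc m)
  then obtain n' where n': "n = Suc n'" "m \<le> n'" by (cases n) auto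
  let ?C = "real (n' choose m)"
  have C: "?C > 0" using n' by simp
  have "real (Suc m) * real (n choose Suc m) = real n * ?C"
    using Suc_times_binomial_eq[of n' m] n' by (metis mult.commute of_nat_mult)
  moreover have "real (n - m) * real (n choose m) = real n * ?C"
    using binomial_absorb_comp[of n m] n' by (metis diff_Suc_1 of_nat_mult)
  moreover have div: "1 / y = a / b" if "a * y = b" "b > 0" for a y b :: real
    using that by (auto simp: field_simps)
  ultimately have inv: "1 / real (n choose Suc m) = real (Suc m) / (real n * ?C)"
      "1 / real (n choose m) = real (n - m) / (real n * ?C)"
    by (intro div; use C n' in simp)+
  have "1 / (real (n+1) * real (n choose m)) + 1 / (real (n+1) * real (n choose Suc m))
      = (1 / real (n choose m) + 1 / real (n choose Suc m)) / real (n+1)"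
    by (simp add: add_divide_distrib mult.commute)
  also have "\<dots> = (real (n - m) + real (Suc m)) / (real n * ?C) / real (n+1)"
    by (simp only: inv add_divide_distrib)
  also have "\<dots> = 1 / (real n * ?C)"
    using n' C by (simp add: of_nat_diff divide_simps)
  finally have leib: "1 / (real (n+1) * real (n choose Suc m))
      = 1 / (real n * ?C) - 1 / (real (n+1) * real (n choose m))" by simp
  have "Lcm {1..n'+1} dvd Lcm {1..n+1}" using n' by (intro Lcm_subset) auto
  then obtain k where k: "Lcm {1..n+1} = Lcm {1..n'+1} * k" by (elim dvdE)
  have "real (Lcm {1..n+1}) / (real n * ?C) = real k * (real (Lcm {1..n'+1}) / (real (n'+1) * ?C))"
    unfolding k using n' by simp
  also have "\<dots> \<in> \<int>" using Suc.IH[OF n'(2)] by (intro Ints_mult) auto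
  finally have "real (Lcm {1..n+1}) / (real n * ?C)
      - real (Lcm {1..n+1}) / (real (n+1) * real (n choose m)) \<in> \<int>"
    using Suc.IH[of n] n' by (intro Ints_diff) auto
  also have "real (Lcm {1..n+1}) / (real n * ?C)
      - real (Lcm {1..n+1}) / (real (n+1) * real (n choose m))
      = real (Lcm {1..n+1}) * (1 / (real n * ?C) - 1 / (real (n+1) * real (n choose m)))"
    by (simp add: right_diff_distrib)
  also have "\<dots> = real (Lcm {1..n+1}) * (1 / (real (n+1) * real (n choose Suc m)))"
    by (simp only: leib)
  finally show ?case by simp
qed

text \<open>The quotient of the least common multiple by
  \<open>(2 * j + 1) * (2 * j choose j)\<close> is a positive integer, hence at least 1, and the
  central binomial coefficient is at least \<open>4 ^ j / (2 * j)\<close>.\<close>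

lemma four_power_le_Lcm: "4 ^ j \<le> Lcm {1..2 * j + 1 :: nat}"
proof (cases "j = 0")
  case False
  let ?d = "real (2 * j + 1) * real (2 * j choose j)"
  let ?L = "real (Lcm {1..2 * j + 1})"
  have d: "?d > 0" by simp
  have "Lcm {1..2 * j + 1} \<noteq> 0" by (simp add: Lcm_0_iff_nat)
  then have "0 < ?L / ?d" using d by (intro divide_pos_pos) linarith+
  moreover have "?L / ?d \<in> \<int>" using Lcm_div_leibniz_in_Ints[of j "2 * j"] by simp
  moreover have "1 \<le> y" if "0 < y" "y \<in> \<int>" for y :: real using that by (auto elim!: Ints_cases)
  ultimately have "1 \<le> ?L / ?d" by blast
  then have L: "?d \<le> ?L" by (simp only: le_divide_eq_1_pos[OF d])
  have "4 ^ j / (2 * real j) \<le> real (2 * j choose j)"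
    using central_binomial_lower_bound[of j] False by simp
  then have "4 ^ j \<le> 2 * real j * real (2 * j choose j)"
    using False by (simp add: field_simps)
  also have "\<dots> \<le> ?d" by (intro mult_right_mono) auto
  also note L
  finally have "real (4 ^ j) \<le> ?L" by (simp only: of_nat_power of_nat_numeral)
  then show ?thesis by (simp only: of_nat_le_iff)
qed simp

text \<open>The multiplicity of a prime in a least common multiple is the maximum of its
  multiplicities in the elements, so some element attains it.\<close>

lemma prime_power_dvd_Lcm_nat:
  fixes p :: nat
  assumes "prime p" "finite A" "p ^ k dvd Lcm A" "0 \<notin> A" "k > 0"
  shows "\<exists>a\<in>A. p ^ k dvd a"
  using assms(2-)
proof (induction A rule: finite_induct)
  case empty
  then show ?case using assms(1) by (auto simp: prime_nat_iff)
next
  case (insert a A)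
  have nz: "a \<noteq> 0" "Lcm A \<noteq> 0" using insert by (auto simp: Lcm_0_iff_nat)
  have "k \<le> multiplicity p (lcm a (Lcm A))"
    using insert.prems nz assms(1) by (intro multiplicity_geI) (auto simp: lcm_eq_0_iff prime_nat_iff)
  also have "\<dots> = max (multiplicity p a) (multiplicity p (Lcm A))"
    using nz assms(1) by (simp add: prime_factorization_lcm flip: count_prime_factorization_prime)
  finally have "p ^ k dvd a \<or> p ^ k dvd Lcm A"
    by (auto simp: le_max_iff_disj multiplicity_dvd')
  then show ?case using insert by auto
qed

text \<open>Let \<open>T = 4 * N\<^sup>2 + 1\<close>. Without a prime above \<open>N\<close> and up
  to \<open>T\<close>, \<open>Lcm {1..T}\<close> is a product of at most \<open>N\<close> prime
  powers, each at most \<open>T\<close>, so it is at most \<open>T ^ N\<close>. This contradicts the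
  lower bound \<open>4 ^ (2 * N\<^sup>2) = (16 ^ N) ^ N\<close>.\<close>

lemma exists_prime_between:
  fixes N :: nat
  assumes "N \<ge> 1"
  shows "\<exists>p. prime p \<and> N < p \<and> p \<le> 4 * N\<^sup>2 + 1"
proof (rule ccontr)
  assume no: "\<not> ?thesis"
  define T where "T = 4 * N\<^sup>2 + 1"
  define L where "L = Lcm {1..T}"
  have L0: "L \<noteq> 0" unfolding L_def by (simp add: Lcm_0_iff_nat)
  have bound: "p ^ multiplicity p L \<le> T \<and> p \<in> {1..N}" if p: "p \<in> prime_factors L" for p
  proof -
    have pp: "prime p" "p dvd L" using p by auto
    have "multiplicity p L > 0" using pp L0 by (simp add: prime_multiplicity_gt_zero_iff)
    then obtain a where a: "a \<in> {1..T}" "p ^ multiplicity p L dvd a"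
      using prime_power_dvd_Lcm_nat[OF pp(1), of "{1..T}" "multiplicity p L"]
      by (auto simp: L_def multiplicity_dvd)
    then have "p ^ multiplicity p L \<le> T" by (meson atLeastAtMost_iff dvd_imp_le le_trans less_le_trans zero_less_one)
    moreover have "p \<le> p ^ multiplicity p L"
      using \<open>multiplicity p L > 0\<close> pp(1) by (simp add: self_le_power prime_gt_0_nat Suc_leI)
    ultimately have "p \<le> T" by simp
    then have "p \<le> N" using no pp(1) by (auto simp: T_def not_less)
    then show ?thesis using \<open>p ^ multiplicity p L \<le> T\<close> prime_ge_1_nat[OF pp(1)] by simp
  qed
  have "L = (\<Prod>p\<in>prime_factors L. p ^ multiplicity p L)"
    using L0 by (intro prime_factorization_nat) simp
  also have "\<dots> \<le> (\<Prod>p\<in>prime_factors L. T)" using bound by (intro prod_mono) auto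
  also have "\<dots> = T ^ card (prime_factors L)" by simp
  also have "\<dots> \<le> T ^ N"
  proof (intro power_increasing)
    have "card (prime_factors L) \<le> card {1..N}" using bound by (intro card_mono) auto
    then show "card (prime_factors L) \<le> N" by simp
  qed (simp add: T_def)
  finally have "L \<le> T ^ N" .
  have "4 ^ (2 * N\<^sup>2) \<le> L" using four_power_le_Lcm[of "2 * N\<^sup>2"] by (simp add: L_def T_def)
  then have "(16 ^ N) ^ N \<le> L"
    by (simp add: power2_eq_square power_mult)
  moreover have "4 * N\<^sup>2 + 1 < 16 ^ N"
    using assms
  proof (induction N rule: nat_induct_at_least)
    case base then show ?case by simp
  next
    case (Suc n)
    have "n \<le> n * n" by (rule le_square)
    moreover have "4 * (Suc n)\<^sup>2 + 1 = 4 * (n * n) + 8 * n + 5" by (simp add: power2_eq_square)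
    moreover have "4 * (n * n) + 1 < 16 ^ n" using Suc.IH by (simp add: power2_eq_square)
    ultimately show ?case unfolding power_Suc by linarith
  qed
  then have "T ^ N < (16 ^ N) ^ N" using assms by (intro power_strict_mono) (auto simp: T_def)
  ultimately show False using \<open>L \<le> T ^ N\<close> by linarith
qed

section \<open>The Tutte--Berge formula\<close>

lemma is_matching_subset:
  assumes "is_matching E M" "N \<subseteq> M"
  shows "is_matching E N"
  unfolding is_matching_def
proof (intro conjI ballI impI)
  show "N \<subseteq> E" using assms(2) by (rule subset_trans) (use assms(1) in \<open>simp add: is_matching_def\<close>)
  fix e f assume "e \<in> N" "f \<in> N" "e \<noteq> f"
  then show "e \<inter> f = {}" using subsetD[OF assms(2)] assms(1) by (simp add: is_matching_def)
qed

lemma card_Union_matching: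
  assumes "is_matching E M" "finite M" "\<forall>e\<in>E. card e = 2"
  shows "card (\<Union>M) = 2 * card M"
proof -
  have two: "\<forall>e\<in>M. card e = 2" using assms by (auto simp: is_matching_def)
  have "pairwise disjnt M" using assms(1) by (auto simp: is_matching_def pairwise_def disjnt_def)
  then have "card (\<Union>M) = sum card M"
    by (rule card_Union_disjoint) (metis two card.infinite zero_neq_numeral)
  also have "\<dots> = 2 * card M" using two by simp
  finally show ?thesis .
qed

text \<open>The easy direction of Tutte--Berge. Edges meeting \<open>U\<close> inject into
  \<open>U\<close> because they are disjoint; every other edge lies inside one part, and a part with
  \<open>s\<close> vertices holds at most \<open>s div 2\<close> disjoint edges.\<close>

lemma matching_card_le_barrier:
  assumes "is_matching E M" "finite V" "\<forall>e\<in>E. e \<subseteq> V \<and> card e = 2"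
    and U: "U \<subseteq> V" and I: "finite I" "c ` (V - U) \<subseteq> I"
    and nocross: "\<And>u v. {u, v} \<in> E \<Longrightarrow> u \<in> U \<or> v \<in> U \<or> c u = c v"
  shows "card M \<le> card U + (\<Sum>i\<in>I. card {v \<in> V - U. c v = i} div 2)"
proof -
  have ME: "M \<subseteq> E" using assms(1) by (simp add: is_matching_def)
  have disj: "e \<inter> f = {}" if "e \<in> M" "f \<in> M" "e \<noteq> f" for e f
    using assms(1) that by (simp add: is_matching_def)
  have "M \<subseteq> Pow V" using ME assms(3) by auto
  then have finM: "finite M" using assms(2) by (meson finite_Pow_iff finite_subset)
  define A where "A = {e \<in> M. e \<inter> U \<noteq> {}}"
  define P where "P i = {e \<in> M. e \<subseteq> {v \<in> V - U. c v = i}}" for i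
  define g where "g e = (SOME v. v \<in> e \<inter> U)" for e
  have g: "g e \<in> e \<inter> U" if "e \<in> A" for e
    using that unfolding g_def A_def by (subst some_in_eq) simp
  have "inj_on g A"
  proof (rule inj_onI)
    fix e f assume ef: "e \<in> A" "f \<in> A" "g e = g f"
    then have "g e \<in> e \<inter> f" using g[of e] g[of f] by simp
    then show "e = f" using ef disj[of e f] unfolding A_def by blast
  qed
  moreover have "g ` A \<subseteq> U" using g by blast
  ultimately have cA: "card A \<le> card U" by (rule card_inj_on_le) (rule finite_subset[OF U assms(2)])
  have cP: "card (P i) \<le> card {v \<in> V - U. c v = i} div 2" for i
  proof -
    have "card (\<Union>(P i)) = 2 * card (P i)"
      using assms(3) finM
      by (intro card_Union_matching[of E] is_matching_subset[OF assms(1)]) (auto simp: P_def)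
    moreover have "card (\<Union>(P i)) \<le> card {v \<in> V - U. c v = i}"
      using assms(2) by (intro card_mono) (auto simp: P_def)
    ultimately show ?thesis by linarith
  qed
  have "M \<subseteq> A \<union> (\<Union>i\<in>I. P i)"
  proof
    fix e assume e: "e \<in> M"
    then have eV: "e \<subseteq> V" "card e = 2" using ME assms(3) by auto
    then obtain u v where uv: "e = {u, v}" by (auto simp: card_2_iff)
    show "e \<in> A \<union> (\<Union>i\<in>I. P i)"
    proof (cases "e \<inter> U = {}")
      case True
      then have "c u = c v" using nocross[of u v] e ME uv by auto
      then have "e \<in> P (c u)" "c u \<in> I" using e uv eV True I by (auto simp: P_def)
      then show ?thesis by blast
    qed (use e in \<open>auto simp: A_def\<close>)
  qed
  then have "card M \<le> card (A \<union> (\<Union>i\<in>I. P i))"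
    using finM I by (intro card_mono) (auto simp: A_def P_def)
  moreover have "\<dots> \<le> card A + card (\<Union>i\<in>I. P i)" by (rule card_Un_le)
  moreover have "card (\<Union>i\<in>I. P i) \<le> (\<Sum>i\<in>I. card (P i))" using I by (intro card_UN_le)
  moreover have "\<dots> \<le> (\<Sum>i\<in>I. card {v \<in> V - U. c v = i} div 2)"
    by (rule sum_mono) (rule cP)
  ultimately show ?thesis using cA by linarith
qed

section \<open>Gallai's lemma and tight barriers\<close>

definition maximum_matching :: "nat set set \<Rightarrow> nat set set \<Rightarrow> bool" where
  "maximum_matching E M \<longleftrightarrow> is_matching E M \<and> (\<forall>N. is_matching E N \<longrightarrow> card N \<le> card M)"

lemma exists_maximum_matching:
  assumes "finite E"
  shows "\<exists>M. maximum_matching E M"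
proof -
  have "is_matching E {}" by (simp add: is_matching_def)
  moreover have "\<forall>M. is_matching E M \<longrightarrow> card M < Suc (card E)"
    using assms by (auto simp: is_matching_def less_Suc_eq_le intro: card_mono)
  ultimately show ?thesis
    unfolding maximum_matching_def
    using ex_has_greatest_nat[of "is_matching E" "{}" card "Suc (card E)"] by blast
qed

lemma insert_matching:
  assumes "is_matching E N" "e \<in> E" "e \<inter> \<Union>N = {}"
  shows "is_matching E (insert e N)"
  unfolding is_matching_def
proof (intro conjI ballI impI)
  show "insert e N \<subseteq> E" using assms by (simp add: is_matching_def)
  fix f g assume "f \<in> insert e N" "g \<in> insert e N" "f \<noteq> g"
  then consider "f = e" "g \<in> N" | "g = e" "f \<in> N" | "f \<in> N" "g \<in> N" by blast
  then show "f \<inter> g = {}"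
  proof cases
    case 3
    then show ?thesis using assms(1) \<open>f \<noteq> g\<close> by (simp add: is_matching_def)
  qed (use assms(3) in blast)+
qed

lemma maximum_matching_meets_edge:
  assumes "maximum_matching E N" "finite E" "e \<in> E" "e \<noteq> {}"
  shows "e \<inter> \<Union>N \<noteq> {}"
proof
  assume *: "e \<inter> \<Union>N = {}"
  then have "is_matching E (insert e N)"
    using assms by (intro insert_matching) (auto simp: maximum_matching_def)
  then have "card (insert e N) \<le> card N" using assms by (auto simp: maximum_matching_def)
  moreover have "e \<notin> N" using * assms(4) by auto
  moreover have "finite N"
    using assms by (auto simp: maximum_matching_def is_matching_def intro: finite_subset)
  ultimately show False by simp
qed

text \<open>The disjunct \<open>u = v\<close> makes the relation reflexive; once it is also
  transitive, its classes serve as the parts.\<close>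

definition never_both_missed :: "nat set set \<Rightarrow> nat \<Rightarrow> nat \<Rightarrow> bool" where
  "never_both_missed E u v \<longleftrightarrow> u = v \<or> (\<forall>M. maximum_matching E M \<longrightarrow> u \<in> \<Union>M \<or> v \<in> \<Union>M)"

text \<open>Gallai's lemma. If a maximum matching \<open>M\<close> misses \<open>u\<close> and \<open>v\<close>, take a maximum matching \<open>N\<close>
  missing \<open>t\<close> with \<open>M \<inter> N\<close> as large as possible; exchanging one edge enlarges the intersection.\<close>
lemma never_both_missed_trans:
  assumes fin: "finite E" and two: "\<forall>e\<in>E. card e = 2"
    and miss_t: "maximum_matching E K" "t \<notin> \<Union>K"
    and ut: "never_both_missed E u t" and tv: "never_both_missed E t v"
  shows "never_both_missed E u v"
proof (rule ccontr)
  assume "\<not> never_both_missed E u v"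
  then obtain M where uv: "u \<noteq> v" and M: "maximum_matching E M" "u \<notin> \<Union>M" "v \<notin> \<Union>M"
    by (auto simp: never_both_missed_def)
  have finm: "finite N" if "maximum_matching E N" for N
    using that fin by (auto simp: maximum_matching_def is_matching_def intro: finite_subset)
  have ne: "u \<noteq> t" "t \<noteq> v" using \<open>\<not> never_both_missed E u v\<close> ut tv by auto
  have tM: "t \<in> \<Union>M" using ut M ne unfolding never_both_missed_def by blast
  let ?Q = "\<lambda>N. maximum_matching E N \<and> t \<notin> \<Union>N"
  have "\<forall>N. ?Q N \<longrightarrow> card (M \<inter> N) < Suc (card M)"
    using finm[OF M(1)] by (auto simp: less_Suc_eq_le intro: card_mono)
  then obtain N where N: "maximum_matching E N" "t \<notin> \<Union>N"
    and opt: "\<And>N'. ?Q N' \<Longrightarrow> card (M \<inter> N') \<le> card (M \<inter> N)"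
    using ex_has_greatest_nat[of ?Q K "\<lambda>N. card (M \<inter> N)" "Suc (card M)"] miss_t by blast
  have uvN: "u \<in> \<Union>N" "v \<in> \<Union>N" using ut tv N ne unfolding never_both_missed_def by blast+
  have Nm: "is_matching E N" and Mm: "is_matching E M" using N M by (auto simp: maximum_matching_def)
  have "card M = card N" using M(1) N(1) by (simp add: maximum_matching_def le_antisym)
  then have cU: "card (\<Union>M) = card (\<Union>N)"
    using card_Union_matching[OF Mm finm[OF M(1)] two] card_Union_matching[OF Nm finm[OF N(1)] two] by simp
  have fe: "finite e" if "e \<in> E" for e using that two by (metis card.infinite zero_neq_numeral)
  have fU: "finite (\<Union>M)" "finite (\<Union>N)"
    using finm[OF M(1)] finm[OF N(1)] Mm Nm fe
    by (intro finite_Union; simp add: is_matching_def subset_iff)+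
  \<comment> \<open>\<open>M\<close> and \<open>N\<close> cover equally many vertices, and
    \<open>u\<close> and \<open>v\<close> are covered only by \<open>N\<close>. So at least two
    vertices are covered only by \<open>M\<close>, and one of them differs from
    \<open>t\<close>.\<close>
  have "\<exists>x. x \<in> \<Union>M - \<Union>N \<and> x \<noteq> t"
  proof (rule ccontr)
    assume "\<not> ?thesis"
    then have "\<Union>M - \<Union>N \<subseteq> {t}" by blast
    then have "card (\<Union>M - \<Union>N) \<le> 1" using card_mono[of "{t}"] by fastforce
    moreover have "card (\<Union>M - \<Union>N) = card (\<Union>N - \<Union>M)"
      using cU fU card_Diff_subset_Int[of "\<Union>M" "\<Union>N"] card_Diff_subset_Int[of "\<Union>N" "\<Union>M"]
      by (simp add: Int_commute)
    moreover have "card {u, v} \<le> card (\<Union>N - \<Union>M)"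
      using uvN M fU by (intro card_mono) auto
    ultimately show False using uv by simp
  qed
  then obtain x e where x: "x \<in> e" "e \<in> M" "x \<notin> \<Union>N" "x \<noteq> t" by blast
  have eE: "e \<in> E" using x M by (auto simp: maximum_matching_def is_matching_def)
  then have "card e = 2" using two by blast
  then obtain y where y: "e = {x, y}" "x \<noteq> y" using x(1) by (auto simp: card_2_iff)
  have "y \<in> \<Union>N" using maximum_matching_meets_edge[OF N(1) fin eE] y x by auto
  then obtain f where f: "f \<in> N" "y \<in> f" by blast
  have eN: "e \<notin> N" "e \<noteq> f" using x f by auto
  have disj: "g = h" if "is_matching E A" "g \<in> A" "h \<in> A" "z \<in> g" "z \<in> h" for A g h and z :: nat
    using that by (auto simp: is_matching_def)
  \<comment> \<open>\<open>e\<close> and \<open>f\<close> share \<open>y\<close>, so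
    \<open>f\<close> in \<open>M\<close> would force \<open>f = e\<close>. Hence exchanging
    \<open>f\<close> for \<open>e\<close> loses no edge of \<open>M\<close>.\<close>
  have fM: "f \<notin> M" using disj[OF Mm x(2) _ _ f(2)] y(1) eN(2) by blast
  let ?N = "insert e (N - {f})"
  have yf: "y \<notin> \<Union>(N - {f})" using disj[OF Nm f(1) _ f(2)] by blast
  have "e \<inter> \<Union>(N - {f}) = {}" using x(3) yf y(1) by blast
  then have "is_matching E ?N"
    using is_matching_subset[OF Nm, of "N - {f}"] eE by (intro insert_matching) auto
  moreover have "card ?N = card N"
    using eN f card_Suc_Diff1[OF finm[OF N(1)] f(1)] finm[OF N(1)] by simp
  ultimately have "maximum_matching E ?N" using N(1) by (simp add: maximum_matching_def)
  moreover have "t \<notin> \<Union>?N" using N(2) x(4) y(1) \<open>y \<in> \<Union>N\<close> by blast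
  ultimately have "card (M \<inter> ?N) \<le> card (M \<inter> N)" using opt by blast
  moreover have "M \<inter> ?N = insert e (M \<inter> N)" using x(2) fM by blast
  ultimately show False using eN finm[OF M(1)] by simp
qed

text \<open>The case of an empty barrier. Since every vertex is missed by some maximum matching,
  Gallai's lemma makes \<open>never_both_missed\<close> an equivalence. Its classes are the parts:
  the ends of an edge are related, and a maximum matching leaves at most one vertex of each class
  uncovered.\<close>

lemma exists_tight_barrier_if_all_missable:
  assumes finV: "finite V" and E: "\<forall>e\<in>E. e \<subseteq> V \<and> card e = 2"
    and missable: "\<And>v. v \<in> V \<Longrightarrow> \<exists>M. maximum_matching E M \<and> v \<notin> \<Union>M"
  shows "\<exists>c M. c ` V \<subseteq> V \<and> (\<forall>u v. {u, v} \<in> E \<longrightarrow> c u = c v) \<and>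
    is_matching E M \<and> card M = (\<Sum>i\<in>V. card {v \<in> V. c v = i} div 2)"
proof -
  have finE: "finite E" by (rule finite_subset[of _ "Pow V"]) (use finV E in auto)
  let ?R = "never_both_missed E"
  have sym: "?R u v \<Longrightarrow> ?R v u" for u v by (auto simp: never_both_missed_def)
  have trans: "?R u v" if "?R u t" "?R t v" "t \<in> V" for u t v
  proof -
    obtain K where "maximum_matching E K" "t \<notin> \<Union>K" using missable[OF \<open>t \<in> V\<close>] by blast
    then show ?thesis using E by (intro never_both_missed_trans[OF finE _ _ _ that(1,2)]) auto
  qed
  \<comment> \<open>Related vertices satisfy the same predicate under \<open>SOME\<close>, so each
    class receives a single representative as its label.\<close>
  define c where "c v = (SOME u. u \<in> V \<and> ?R v u)" for v
  have c: "c v \<in> V \<and> ?R v (c v)" if "v \<in> V" for v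
    unfolding c_def by (rule someI[of _ v]) (use that in \<open>simp add: never_both_missed_def\<close>)
  have c_iff: "c u = c v \<longleftrightarrow> ?R u v" if "u \<in> V" "v \<in> V" for u v
  proof
    assume "c u = c v" then show "?R u v" 
      using c[OF that(1)] c[OF that(2)] trans[of u "c u" v] sym[of v "c v"] by simp
  next
    assume "?R u v"
    then have "(\<lambda>w. w \<in> V \<and> ?R u w) = (\<lambda>w. w \<in> V \<and> ?R v w)"
      using that sym[of u v] trans[of u v] trans[of v u] by (intro ext) blast
    then show "c u = c v" by (simp add: c_def)
  qed
  have nocross: "c u = c v" if uv: "{u, v} \<in> E" for u v
  proof -
    have "?R u v"
      using maximum_matching_meets_edge[OF _ finE uv] by (auto simp: never_both_missed_def)
    then show ?thesis using c_iff uv E by auto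
  qed
  obtain M where M: "maximum_matching E M" using exists_maximum_matching[OF finE] by blast
  then have Mm: "is_matching E M" by (simp add: maximum_matching_def)
  then have ME: "M \<subseteq> E" by (simp add: is_matching_def)
  then have finM: "finite M" using finE finite_subset by blast
  define P where "P i = {e \<in> M. e \<subseteq> {v \<in> V. c v = i}}" for i
  have cls: "card (P i) = card {v \<in> V. c v = i} div 2" for i
  proof -
    let ?C = "{v \<in> V. c v = i}"
    have "card (\<Union>(P i)) = 2 * card (P i)"
      using E finM by (intro card_Union_matching[of E] is_matching_subset[OF Mm]) (auto simp: P_def)
    moreover have "\<Union>(P i) \<subseteq> ?C" by (auto simp: P_def)
    moreover have "card (?C - \<Union>(P i)) \<le> Suc 0"
    proof (subst card_le_Suc0_iff_eq)
      \<comment> \<open>The partner of \<open>v\<close> in \<open>M\<close> would lie in the same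
        class by \<open>nocross\<close>, so the edge would belong to \<open>P i\<close>.\<close>
      have missed: "v \<notin> \<Union>M" if v: "v \<in> ?C - \<Union>(P i)" for v
      proof
        assume "v \<in> \<Union>M"
        then obtain e where e: "e \<in> M" "v \<in> e" by blast
        then have "e \<in> E" using ME by auto
        then have "card e = 2" using E by blast
        then obtain w where "e = {v, w}" using e(2) by (auto simp: card_2_iff)
        then have "e \<in> P i" using e v nocross[of v w] \<open>e \<in> E\<close> E by (auto simp: P_def)
        then show False using v e by blast
      qed
      show "\<forall>u\<in>?C - \<Union>(P i). \<forall>v\<in>?C - \<Union>(P i). u = v"
      proof (intro ballI)
        fix u v assume u: "u \<in> ?C - \<Union>(P i)" and v: "v \<in> ?C - \<Union>(P i)"
        then have "?R u v" using c_iff[of u v] by simp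
        then show "u = v" using missed[OF u] missed[OF v] M unfolding never_both_missed_def by blast
      qed
    qed (use finV in auto)
    moreover have "card (?C - \<Union>(P i)) = card ?C - card (\<Union>(P i))"
      using finV \<open>\<Union>(P i) \<subseteq> ?C\<close> by (intro card_Diff_subset) (auto intro: finite_subset)
    moreover have "card (\<Union>(P i)) \<le> card ?C"
      using finV \<open>\<Union>(P i) \<subseteq> ?C\<close> by (intro card_mono) auto
    ultimately show ?thesis by linarith
  qed
  have "M = (\<Union>i\<in>V. P i)"
  proof (intro equalityI subsetI)
    fix e assume e: "e \<in> M"
    then have eV: "e \<subseteq> V" "card e = 2" using ME E by auto
    then obtain u w where uw: "e = {u, w}" by (auto simp: card_2_iff)
    then have "u \<in> V" "w \<in> V" using eV by auto
    then have "e \<in> P (c u)" using e nocross[of u w] ME uw by (auto simp: P_def)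
    then show "e \<in> (\<Union>i\<in>V. P i)" using c[OF \<open>u \<in> V\<close>] by blast
  qed (auto simp: P_def)
  moreover have "card (\<Union>i\<in>V. P i) = (\<Sum>i\<in>V. card (P i))"
  proof (rule card_UN_disjoint)
    have "{} \<notin> M" using ME E by force
    moreover have "e = {}" if "e \<in> P i" "e \<in> P j" "i \<noteq> j" for e i j using that by (auto simp: P_def)
    ultimately show "\<forall>i\<in>V. \<forall>j\<in>V. i \<noteq> j \<longrightarrow> P i \<inter> P j = {}" by (auto simp: P_def)
  qed (use finV finM in \<open>auto simp: P_def\<close>)
  ultimately have "card M = (\<Sum>i\<in>V. card {v \<in> V. c v = i} div 2)" using cls by simp
  then show ?thesis using c nocross Mm by blast
qed

text \<open>Unlike in the usual form of the Tutte--Berge formula, the parts need not be connected components.\<close>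
lemma exists_tight_barrier:
  assumes "finite V" "\<forall>e\<in>E. e \<subseteq> V \<and> card e = 2"
  shows "\<exists>U c M. U \<subseteq> V \<and> c ` (V - U) \<subseteq> V \<and> (\<forall>u v. {u, v} \<in> E \<longrightarrow> u \<in> U \<or> v \<in> U \<or> c u = c v) \<and>
    is_matching E M \<and> card M = card U + (\<Sum>i\<in>V. card {v \<in> V - U. c v = i} div 2)"
  using assms
proof (induction V arbitrary: E rule: finite_psubset_induct)
  case (psubset V)
  show ?case
  \<comment> \<open>If some vertex \<open>x\<close> is covered by every maximum matching, it goes
    into the barrier: deleting it lowers the matching number by exactly one, and the induction
    hypothesis handles the rest.\<close>
  proof (cases "\<exists>v\<in>V. \<forall>M. maximum_matching E M \<longrightarrow> v \<in> \<Union>M")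
    case False
    then have "\<exists>c M. c ` V \<subseteq> V \<and> (\<forall>u v. {u, v} \<in> E \<longrightarrow> c u = c v) \<and>
        is_matching E M \<and> card M = (\<Sum>i\<in>V. card {v \<in> V. c v = i} div 2)"
      using psubset by (intro exists_tight_barrier_if_all_missable) auto
    then show ?thesis by (intro exI[of _ "{}"]) auto
  next
    case True
    then obtain x where x: "x \<in> V" "\<And>M. maximum_matching E M \<Longrightarrow> x \<in> \<Union>M" by blast
    define E' where "E' = {e \<in> E. x \<notin> e}"
    have sub: "V - {x} \<subset> V" using x by blast
    have E': "\<forall>e\<in>E'. e \<subseteq> V - {x} \<and> card e = 2" using psubset.prems by (auto simp: E'_def)
    obtain U c N where IH: "U \<subseteq> V - {x} \<and> c ` (V - {x} - U) \<subseteq> V - {x} \<and>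
        (\<forall>u v. {u, v} \<in> E' \<longrightarrow> u \<in> U \<or> v \<in> U \<or> c u = c v) \<and> is_matching E' N \<and>
        card N = card U + (\<Sum>i\<in>V - {x}. card {v \<in> V - {x} - U. c v = i} div 2)"
      using psubset.IH[OF sub E'] by (elim exE) (rule that)
    then have U: "U \<subseteq> V - {x}" and cV: "c ` (V - {x} - U) \<subseteq> V - {x}"
      and N: "is_matching E' N"
      and cN: "card N = card U + (\<Sum>i\<in>V - {x}. card {v \<in> V - {x} - U. c v = i} div 2)"
      by simp_all
    from IH have nc: "u \<in> U \<or> v \<in> U \<or> c u = c v" if "{u, v} \<in> E'" for u v
      using that by (elim conjE allE) (erule impE)
    have finE: "finite E"
      by (rule finite_subset[of _ "Pow V"]) (use psubset.prems psubset.hyps in auto)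
    then obtain M where M: "maximum_matching E M" using exists_maximum_matching by blast
    then have Mm: "is_matching E M" by (simp add: maximum_matching_def)
    then have finM: "finite M" using finE by (auto simp: is_matching_def intro: finite_subset)
    obtain e where e: "e \<in> M" "x \<in> e" using x(2)[OF M] by blast
    have "is_matching E' (M - {e})" using Mm e by (auto simp: is_matching_def E'_def)
    \<comment> \<open>The other edges of \<open>M\<close> avoid \<open>x\<close>, so the barrier of
      the graph without \<open>x\<close> bounds their number.\<close>
    then have "card (M - {e}) \<le> card N"
      unfolding cN using psubset.hyps E' U cV
      by (intro matching_card_le_barrier nc) auto
    \<comment> \<open>\<open>N\<close> is a matching of \<open>E\<close> that misses
      \<open>x\<close>, so it is not maximum.\<close>
    moreover have "card N < card M"
    proof -
      have "is_matching E N" "x \<notin> \<Union>N" using N by (auto simp: is_matching_def E'_def)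
      then show ?thesis using M x(2)[of N] by (force simp: maximum_matching_def)
    qed
    ultimately have cM: "card M = Suc (card N)" using e finM by simp
    \<comment> \<open>No remaining vertex carries the label \<open>x\<close>, so summing over
      \<open>V\<close> instead of \<open>V - {x}\<close> adds only a zero term.\<close>
    have "card {v \<in> V - {x} - U. c v = x} = 0" using cV by (auto simp: card_eq_0_iff)
    moreover have "V - insert x U = V - {x} - U" by auto
    ultimately have "(\<Sum>i\<in>V. card {v \<in> V - insert x U. c v = i} div 2)
        = (\<Sum>i\<in>V - {x}. card {v \<in> V - {x} - U. c v = i} div 2)"
      using psubset.hyps x(1) by (simp only: sum.remove[of V x])
    moreover have "finite U" by (rule finite_subset[OF U]) (use psubset.hyps in simp)
    moreover have "x \<notin> U" using U by blast
    ultimately have "card M = card (insert x U) + (\<Sum>i\<in>V. card {v \<in> V - insert x U. c v = i} div 2)"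
      using cM cN by simp
    moreover have "u \<in> insert x U \<or> v \<in> insert x U \<or> c u = c v" if "{u, v} \<in> E" for u v
      using that nc[of u v] by (auto simp: E'_def)
    ultimately show ?thesis using U x(1) cV Mm
      by (intro exI[of _ "insert x U"] exI[of _ c] exI[of _ M]) auto
  qed
qed

section \<open>Schemes from certificate tests\<close>

lemma exists_bit_code:
  assumes "finite A" "card A \<le> 2 ^ l"
  shows "\<exists>f. inj_on f A \<and> (\<forall>x\<in>A. length (f x :: bool list) = l)"
proof -
  have "finite {bs :: bool list. set bs \<subseteq> UNIV \<and> length bs = l}"
    by (rule finite_lists_length_eq) simp
  moreover have "card {bs :: bool list. set bs \<subseteq> UNIV \<and> length bs = l} = 2 ^ l"
    by (subst card_lists_length_eq) simp_all
  ultimately obtain f where "f ` A \<subseteq> {bs :: bool list. set bs \<subseteq> UNIV \<and> length bs = l}" "inj_on f A"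
    using card_le_inj[OF assms(1), of "{bs :: bool list. set bs \<subseteq> UNIV \<and> length bs = l}"] assms(2) by auto
  then show ?thesis by (intro exI[of _ f]) auto
qed

lemma run_return_pmf:
  "run init (\<lambda>q s. return_pmf (f q s)) ss = map_pmf (\<lambda>q. foldl f q ss) init"
  unfolding run_def
  by (induction ss arbitrary: init) (simp_all add: pmf.map_comp o_def map_pmf_def[symmetric])

text \<open>The verifier keeps the code of its sketch followed by the first \<open>H\<close> annotation bits; decoding and
  testing happen only after the stream has ended.\<close>
lemma scheme_of_certificate_test:
  fixes upd :: "'q \<Rightarrow> token \<Rightarrow> 'q" and test :: "'q \<Rightarrow> 'c \<Rightarrow> nat option"
  assumes m: "m > 0"
    and Q: "finite Q" "card Q \<le> 2 ^ P" "Q\<^sub>0 \<subseteq> Q" "Q\<^sub>0 \<noteq> {}" "\<And>q t. q \<in> Q \<Longrightarrow> upd q t \<in> Q"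
    and C: "finite C" "card C \<le> 2 ^ H" "\<And>xs. strict_turnstile n B xs \<Longrightarrow> cert xs \<in> C"
    and complete: "\<And>xs q. strict_turnstile n B xs \<Longrightarrow> q \<in> Q\<^sub>0 \<Longrightarrow>
      test (foldl upd q xs) (cert xs) = Some (max_matching xs)"
    and sound: "\<And>xs c. strict_turnstile n B xs \<Longrightarrow> c \<in> C \<Longrightarrow>
      real (card {q \<in> Q\<^sub>0. test (foldl upd q xs) c \<notin> {Some (max_matching xs), None}}) \<le> eps * real (card Q\<^sub>0)"
    and "eps \<ge> 0"
  shows "\<exists>h init step out. online_maxmatching_scheme n B m h init step out H (P + H) eps"
proof -
  obtain enc :: "'q \<Rightarrow> bool list" where enc: "inj_on enc Q" "\<And>q. q \<in> Q \<Longrightarrow> length (enc q) = P"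
    using exists_bit_code[OF Q(1,2)] by blast
  obtain code :: "'c \<Rightarrow> bool list" where code: "inj_on code C" "\<And>c. c \<in> C \<Longrightarrow> length (code c) = H"
    using exists_bit_code[OF C(1,2)] by blast
  \<comment> \<open>Truncation to \<open>P + H\<close> bits enforces the space bound on arbitrary
    input; surplus annotation bits are dropped.\<close>
  define f where "f q s = take (P + H) (case s of
      Tok t \<Rightarrow> enc (upd (inv_into Q enc (take P q)) t) @ drop P q | Bit b \<Rightarrow> q @ [b])" for q s
  define init where "init = map_pmf enc (pmf_of_set Q\<^sub>0)"
  define step where "step q s = return_pmf (f q s)" for q s
  define out where "out q = (if drop P q \<in> code ` C
      then test (inv_into Q enc (take P q)) (inv_into C code (drop P q)) else None)" for q
  \<comment> \<open>A prefix of length \<open>m\<close> is the whole stream, so the online prover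
    stays silent until the last token.\<close>
  define h where "h xs = (if length xs = m \<and> strict_turnstile n B xs then code (cert xs) else [])" for xs
  have finQ0: "finite Q\<^sub>0" using Q(1,3) finite_subset by blast
  have foldl_Q: "foldl upd q xs \<in> Q" if "q \<in> Q" for q xs
    using that Q(5) by (induction xs arbitrary: q) auto
  have tok: "f (enc q @ w) (Tok t) = enc (upd q t) @ w" if "q \<in> Q" "length w \<le> H" for q w t
    using that enc Q(5) by (simp add: f_def)
  have bits: "foldl f (enc q @ w) (map Bit u) = enc q @ take H (w @ u)"
    if "q \<in> Q" "length w \<le> H" for q w u
    using that(2)
  proof (induction u arbitrary: w)
    case (Cons b u)
    have "f (enc q @ w) (Bit b) = enc q @ take H (w @ [b])"
      using that(1) enc Cons.prems by (simp add: f_def)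
    then have "foldl f (enc q @ w) (map Bit (b # u)) = enc q @ take H (take H (w @ [b]) @ u)"
      using Cons.IH[of "take H (w @ [b])"] by simp
    also have "take H (take H (w @ [b]) @ u) = take H (w @ b # u)"
      using Cons.prems by (cases "length w = H") auto
    finally show ?case .
  qed simp
  \<comment> \<open>Tokens change only the first \<open>P\<close> bits and annotation bits only
    extend the rest, so it does not matter after which tokens the annotation is inserted.\<close>
  have stream: "foldl f (enc q @ w) (annotate xs a) = enc (foldl upd q xs) @ take H (w @ concat a)"
    if "q \<in> Q" "length w \<le> H" "length a = length xs" for q w xs a
    using that(3,1,2)
  proof (induction a xs arbitrary: q w rule: list_induct2)
    case (Cons u a t xs)
    have "foldl f (enc q @ w) (annotate (t # xs) (u # a))
        = foldl f (foldl f (f (enc q @ w) (Tok t)) (map Bit u)) (annotate xs a)"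
      by (simp add: annotate_def)
    also have "\<dots> = foldl f (enc (upd q t) @ take H (w @ u)) (annotate xs a)"
      using Cons.prems Q(5) by (simp only: tok bits)
    also have "\<dots> = enc (foldl upd (upd q t) xs) @ take H (take H (w @ u) @ concat a)"
      using Cons.prems Q(5) by (intro Cons.IH) auto
    also have "take H (take H (w @ u) @ concat a) = take H (w @ concat (u # a))"
      by (cases "length (w @ u) \<le> H") (use Cons.prems in auto)
    finally show ?case by simp
  qed (simp add: annotate_def)
  \<comment> \<open>The transitions are deterministic: the only randomness is the uniform choice of
    the initial sketch, so probabilities are proportions of \<open>Q\<^sub>0\<close>.\<close>
  have verdict: "measure_pmf.prob (verdict init step out (annotate xs a)) A
      = real (card {q \<in> Q\<^sub>0. out (enc (foldl upd q xs) @ take H (concat a)) \<in> A}) / real (card Q\<^sub>0)"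
    if "length a = length xs" for xs a A
  proof -
    have "verdict init step out (annotate xs a)
        = map_pmf (\<lambda>q. out (foldl f (enc q) (annotate xs a))) (pmf_of_set Q\<^sub>0)"
      unfolding verdict_def step_def run_return_pmf init_def by (simp add: pmf.map_comp o_def)
    also have "\<dots> = map_pmf (\<lambda>q. out (enc (foldl upd q xs) @ take H (concat a))) (pmf_of_set Q\<^sub>0)"
      using stream[of _ "[]" a xs] that Q(3,4) finQ0 by (intro map_pmf_cong) (auto simp: subset_iff)
    finally show ?thesis
      using finQ0 Q(4) by (simp add: measure_pmf_of_set Int_def vimage_def conj_commute)
  qed
  have out: "out (enc q @ code c) = test q c" if "q \<in> Q" "c \<in> C" for q c
    using that enc code by (simp add: out_def)
  have "space_bounded (P + H) init step"
    using enc(2) Q(3,4) finQ0 by (auto simp: space_bounded_def init_def step_def f_def)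
  moreover have "sum_list (map length (honest h xs)) \<le> H \<and>
        measure_pmf.prob (verdict init step out (annotate xs (honest h xs)))
          {r. r \<noteq> Some (max_matching xs)} \<le> eps \<and>
        (\<forall>a. length a = m \<longrightarrow>
           measure_pmf.prob (verdict init step out (annotate xs a))
             {r. r \<notin> {Some (max_matching xs), None}} \<le> eps)"
    if xs: "length xs = m" "strict_turnstile n B xs" for xs
  proof (intro conjI allI impI)
    obtain l where l: "m = Suc l" using m by (cases m) auto
    have "map (\<lambda>i. h (take (Suc i) xs)) [0..<l] = map (\<lambda>i. []) [0..<l]"
      using xs l by (intro map_cong) (auto simp: h_def)
    then have hon: "honest h xs = map (\<lambda>i. []) [0..<l] @ [code (cert xs)]"
      using xs l by (simp add: honest_def h_def)
    then have conc: "concat (honest h xs) = code (cert xs)" by simp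
    have len: "length (code (cert xs)) = H" using C(3) xs code by simp
    show "sum_list (map length (honest h xs)) \<le> H"
      using conc len by (metis length_concat order_refl)
    have "{q \<in> Q\<^sub>0. out (enc (foldl upd q xs) @ take H (concat (honest h xs))) \<in> {r. r \<noteq> Some (max_matching xs)}} = {}"
      using out[OF foldl_Q C(3)[OF xs(2)]] complete[OF xs(2)] Q(3) len by (auto simp: conc)
    moreover have "length (honest h xs) = length xs" by (simp add: honest_def)
    ultimately show "measure_pmf.prob (verdict init step out (annotate xs (honest h xs)))
          {r. r \<noteq> Some (max_matching xs)} \<le> eps"
      using \<open>eps \<ge> 0\<close> by (simp only: verdict card.empty of_nat_0 div_0)
    fix a :: "bool list list" assume a: "length a = m"
    let ?bad = "{q \<in> Q\<^sub>0. out (enc (foldl upd q xs) @ take H (concat a)) \<in> {r. r \<notin> {Some (max_matching xs), None}}}"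
    have "real (card ?bad) \<le> eps * real (card Q\<^sub>0)"
    \<comment> \<open>A string that is no code word is rejected. A code word names a certificate
      fixed independently of the private \<open>q\<close>, which is the situation of
      \<open>sound\<close>.\<close>
    proof (cases "take H (concat a) \<in> code ` C")
      case True
      then obtain c where c: "c \<in> C" "take H (concat a) = code c" by blast
      have "?bad = {q \<in> Q\<^sub>0. test (foldl upd q xs) c \<notin> {Some (max_matching xs), None}}"
        unfolding c(2) using out[OF foldl_Q c(1)] Q(3) by auto
      then show ?thesis using sound[OF xs(2) c(1)] by simp
    next
      case False
      then have "out (enc (foldl upd q xs) @ take H (concat a)) = None" if "q \<in> Q\<^sub>0" for q
        using that Q(3) foldl_Q enc(2) by (auto simp: out_def)
      then have "?bad = {}" by auto
      then show ?thesis using \<open>eps \<ge> 0\<close> by (simp only: card.empty) simp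
    qed
    moreover have "0 < real (card Q\<^sub>0)" using finQ0 Q(4) by (simp add: card_gt_0_iff)
    ultimately show "measure_pmf.prob (verdict init step out (annotate xs a))
             {r. r \<notin> {Some (max_matching xs), None}} \<le> eps"
      unfolding verdict[OF a[folded xs(1)]] by (simp add: divide_le_eq)
  qed
  ultimately show ?thesis unfolding online_maxmatching_scheme_def by blast
qed

section \<open>Polynomial sketches\<close>

text \<open>The Lagrange basis polynomial for the nodes \<open>0, \<dots>, n - 1\<close>, without its constant factor, so
  that it is integral.\<close>
definition node_poly :: "nat \<Rightarrow> nat \<Rightarrow> int poly" where
  "node_poly n u = (\<Prod>j\<in>{..<n} - {u}. [:- int j, 1:])"

text \<open>The value at node \<open>u\<close> is \<open>a u\<close> only up to the factor
  \<open>poly (node_poly n u) (int u)\<close>, which is enough for testing divisibility by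
  \<open>p\<close>.\<close>

definition interp :: "nat \<Rightarrow> (nat \<Rightarrow> int) \<Rightarrow> int poly" where
  "interp n a = (\<Sum>u<n. smult (a u) (node_poly n u))"

text \<open>Node \<open>u\<close> receives the weighted row sum of \<open>A\<close>, up to a squared
  factor. At any point \<open>r\<close> the value depends on \<open>A\<close> only through its
  column interpolations at \<open>r\<close>, which can be maintained before \<open>W\<close> is
  known.\<close>

definition weight_poly :: "nat \<Rightarrow> (nat \<Rightarrow> nat \<Rightarrow> int) \<Rightarrow> (nat \<Rightarrow> nat \<Rightarrow> int) \<Rightarrow> int poly" where
  "weight_poly n A W = (\<Sum>v<n. interp n (\<lambda>u. A u v) * interp n (\<lambda>u. W u v))"

lemma poly_node_poly: "poly (node_poly n u) x = (\<Prod>j\<in>{..<n} - {u}. x - int j)"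
  by (simp add: node_poly_def poly_prod)

lemma poly_interp: "poly (interp n a) x = (\<Sum>u<n. a u * poly (node_poly n u) x)"
  by (simp add: interp_def poly_sum)

lemma poly_interp_node:
  assumes "u < n"
  shows "poly (interp n a) (int u) = a u * poly (node_poly n u) (int u)"
proof -
  have "poly (node_poly n w) (int u) = 0" if "w \<noteq> u" for w
    unfolding poly_node_poly using that assms by (intro prod_zero) auto
  then have "poly (interp n a) (int u) = (\<Sum>w<n. if w = u then a u * poly (node_poly n u) (int u) else 0)"
    unfolding poly_interp by (intro sum.cong) auto
  then show ?thesis using assms by simp
qed

lemma poly_weight_poly_node:
  assumes "u < n"
  shows "poly (weight_poly n A W) (int u) = (\<Sum>v<n. A u v * W u v) * (poly (node_poly n u) (int u))\<^sup>2"
  unfolding weight_poly_def poly_sum poly_mult poly_interp_node[OF assms]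
  by (simp add: sum_distrib_left power2_eq_square algebra_simps)

text \<open>Every factor is a nonzero difference of two nodes and has absolute value less than
  \<open>n\<close>, hence less than \<open>p\<close>.\<close>

lemma prime_not_dvd_node_poly:
  assumes "prime p" "int n \<le> p" "u < n"
  shows "\<not> p dvd poly (node_poly n u) (int u)"
proof
  assume "p dvd poly (node_poly n u) (int u)"
  then obtain j where j: "j < n" "j \<noteq> u" "p dvd int u - int j"
    unfolding poly_node_poly using assms(1) by (auto simp: prime_dvd_prod_iff)
  then have "p \<le> \<bar>int u - int j\<bar>" using dvd_imp_le_int[of "int u - int j" p] assms(1) prime_gt_0_int[of p] by simp
  then show False using j assms by linarith
qed

text \<open>The node factor is prime to \<open>p\<close>, and a row sum in \<open>{0..<p}\<close> is
  divisible by \<open>p\<close> only if it vanishes. Nonnegativity excludes cancellation within the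
  row.\<close>

lemma dvd_weight_poly_node_iff:
  assumes "prime p" "int n \<le> p" "u < n"
    and "\<And>v. v < n \<Longrightarrow> 0 \<le> A u v * W u v" "(\<Sum>v<n. A u v * W u v) < p"
  shows "p dvd poly (weight_poly n A W) (int u) \<longleftrightarrow> (\<forall>v<n. A u v * W u v = 0)"
proof -
  have "p dvd poly (weight_poly n A W) (int u) \<longleftrightarrow> p dvd (\<Sum>v<n. A u v * W u v)"
    using assms(1) prime_not_dvd_node_poly[OF assms(1-3)]
    by (simp add: poly_weight_poly_node[OF assms(3)] prime_dvd_mult_iff prime_dvd_power_iff)
  also have "\<dots> \<longleftrightarrow> (\<Sum>v<n. A u v * W u v) = 0"
  proof
    assume "p dvd (\<Sum>v<n. A u v * W u v)"
    moreover have "0 \<le> (\<Sum>v<n. A u v * W u v)" using assms(4) by (intro sum_nonneg) auto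
    ultimately show "(\<Sum>v<n. A u v * W u v) = 0" using assms(5) zdvd_not_zless[of "\<Sum>v<n. A u v * W u v" p]
      by linarith
  qed simp
  also have "\<dots> \<longleftrightarrow> (\<forall>v<n. A u v * W u v = 0)"
    using assms(4) by (subst sum_nonneg_eq_0_iff) auto
  finally show ?thesis .
qed

lemma degree_interp: "degree (interp n a) \<le> n - 1"
proof -
  have "degree (smult (a u) (node_poly n u)) \<le> n - 1" if "u < n" for u
  proof -
    have "degree (node_poly n u) \<le> (\<Sum>j\<in>{..<n} - {u}. degree [:- int j, 1:])"
      unfolding node_poly_def using degree_prod_sum_le[of "{..<n} - {u}" "\<lambda>j. [:- int j, 1:]"] by (simp add: o_def)
    also have "\<dots> = n - 1" using that by simp
    finally show ?thesis using degree_smult_le le_trans by blast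
  qed
  then show ?thesis unfolding interp_def by (intro degree_sum_le) auto
qed

lemma degree_weight_poly: "n > 0 \<Longrightarrow> degree (weight_poly n A W) < 2 * n"
proof -
  assume "n > 0"
  have "degree (weight_poly n A W) \<le> 2 * n - 1"
    unfolding weight_poly_def
  proof (intro degree_sum_le)
    fix v
    show "degree (interp n (\<lambda>u. A u v) * interp n (\<lambda>u. W u v)) \<le> 2 * n - 1"
      using degree_mult_le[of "interp n (\<lambda>u. A u v)" "interp n (\<lambda>u. W u v)"]
        degree_interp[of n "\<lambda>u. A u v"] degree_interp[of n "\<lambda>u. W u v"] by linarith
  qed simp
  then show ?thesis using \<open>n > 0\<close> by linarith
qed

section \<open>Coefficient vectors and polynomial identity modulo a prime\<close>

definition coeff_poly :: "nat \<Rightarrow> (nat \<Rightarrow> int) \<Rightarrow> int poly" where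
  "coeff_poly d g = (\<Sum>i<d. monom (g i) i)"

lemma degree_coeff_poly: "d > 0 \<Longrightarrow> degree (coeff_poly d g) < d"
proof -
  assume "d > 0"
  have "degree (coeff_poly d g) \<le> d - 1"
    unfolding coeff_poly_def by (intro degree_sum_le) (auto intro: le_trans[OF degree_monom_le])
  then show ?thesis using \<open>d > 0\<close> by linarith
qed

text \<open>Lets the honest prover send residues: reducing the coefficients modulo \<open>p\<close>
  preserves all values modulo \<open>p\<close>.\<close>

lemma coeff_poly_mod_dvd:
  assumes "degree f < d" "\<And>i. i < d \<Longrightarrow> g i = coeff f i mod p"
  shows "p dvd poly (coeff_poly d g) x - poly f x"
proof -
  have "poly f x = (\<Sum>i\<le>degree f. coeff f i * x ^ i)" by (rule poly_altdef)
  also have "\<dots> = (\<Sum>i<d. coeff f i * x ^ i)"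
    using assms(1) by (intro sum.mono_neutral_left) (auto simp: coeff_eq_0 not_le)
  finally have "poly (coeff_poly d g) x - poly f x = (\<Sum>i<d. (g i - coeff f i) * x ^ i)"
    by (simp add: coeff_poly_def poly_sum poly_monom sum_subtractf left_diff_distrib)
  moreover have "p dvd (g i - coeff f i) * x ^ i" if "i < d" for i
    using assms(2)[OF that] by (intro dvd_mult2) (simp add: mod_eq_dvd_iff[symmetric])
  ultimately show ?thesis by (auto intro: dvd_sum)
qed

text \<open>Lagrange's bound on roots modulo a prime, in terms of divisibility. Division by
  \<open>x - a\<close> at a root \<open>a\<close> lowers the degree by one, and since
  \<open>p\<close> is prime, every root other than \<open>a\<close> is a root of the
  quotient.\<close>

lemma dvd_poly_of_many_roots_mod_prime:
  fixes f :: "int poly" and p :: int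
  assumes "prime p" "card {r \<in> {0..<p}. p dvd poly f r} > degree f"
  shows "p dvd poly f x"
  using assms(2)
proof (induction "degree f" arbitrary: f x rule: less_induct)
  case less
  let ?Z = "\<lambda>f. {r \<in> {0..<p}. p dvd poly f r}"
  have "card (?Z f) > 0" using less.prems by linarith
  then obtain a where a: "a \<in> ?Z f" by (metis card_gt_0_iff ex_in_conv)
  define q where "q = synthetic_div f a"
  have f: "poly f y = (y - a) * poly q y + poly f a" for y
    using arg_cong[OF synthetic_div_correct'[of a f], of "\<lambda>g. poly g y"]
    by (simp add: q_def algebra_simps)
  have deg: "degree q = degree f - 1" by (simp add: q_def degree_synthetic_div)
  have sub: "?Z f \<subseteq> insert a (?Z q)"
  proof
    fix r assume r: "r \<in> ?Z f"
    show "r \<in> insert a (?Z q)"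
    proof (cases "p dvd poly q r")
      case False
      have "p dvd (r - a) * poly q r + poly f a" using r f[of r] by simp
      then have "p dvd (r - a) * poly q r" using a by (simp add: dvd_add_left_iff)
      then have "p dvd r - a" using assms(1) False by (simp add: prime_dvd_mult_iff)
      then have "r mod p = a mod p" by (simp add: mod_eq_dvd_iff)
      then show ?thesis using r a by simp
    qed (use r in simp)
  qed
  show ?case
  proof (cases "degree f = 0")
    case True
    then obtain c where "f = [:c:]" by (auto elim: degree_eq_zeroE)
    then show ?thesis using a by auto
  next
    case False
    have "finite (?Z q)" by (rule finite_subset[of _ "{0..<p}"]) auto
    then have "card (?Z f) \<le> card (insert a (?Z q))" using sub by (intro card_mono) auto
    also have "\<dots> \<le> Suc (card (?Z q))" by (rule card_insert_le_m1) auto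
    finally have "card (?Z f) \<le> Suc (card (?Z q))" .
    then have "degree q < card (?Z q)" using less.prems deg False by linarith
    then have "p dvd poly q x" using less.hyps[of q x] deg False by simp
    then show ?thesis using f[of x] a by auto
  qed
qed

lemma card_agreements_mod_prime:
  fixes f g :: "int poly"
  assumes "prime p" "degree f < d" "degree g < d" "\<not> p dvd poly f x - poly g x"
  shows "card {r \<in> {0..<p}. p dvd poly f r - poly g r} < d"
proof -
  have "card {r \<in> {0..<p}. p dvd poly (f - g) r} \<le> degree (f - g)"
    using dvd_poly_of_many_roots_mod_prime[OF assms(1), of "f - g" x] assms(4)
    by (intro leI) auto
  moreover have "degree (f - g) < d" using assms(2,3) by (rule degree_diff_less)
  ultimately show ?thesis by simp
qed

section \<open>Column sketches of the stream\<close>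

lemma mult_snoc: "mult (xs @ [t]) e = mult xs e + (if fst t = e then snd t else 0)"
  by (simp add: mult_def)

text \<open>The state holds the secret point and one residue per column. Edges are unordered, so a
  token changes the columns of both its ends. The restriction to \<open>{..<n}\<close> keeps the
  states in a finite set.\<close>

definition sketch_update :: "nat \<Rightarrow> int \<Rightarrow> int \<times> (nat \<Rightarrow> int) \<Rightarrow> token \<Rightarrow> int \<times> (nat \<Rightarrow> int)" where
  "sketch_update n p = (\<lambda>(r, s) t. (r, \<lambda>v\<in>{..<n}.
     (s v + poly (interp n (\<lambda>u. if fst t = {u, v} then snd t else 0)) r) mod p))"

text \<open>\<open>interp\<close> is linear in the column, so the contributions of the tokens add
  up, and reducing modulo \<open>p\<close> at every step does no harm.\<close>

lemma foldl_sketch_update: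
  "foldl (sketch_update n p) (r, \<lambda>v\<in>{..<n}. 0) xs =
    (r, \<lambda>v\<in>{..<n}. poly (interp n (\<lambda>u. mult xs {u, v})) r mod p)"
proof (induction xs rule: rev_induct)
  case Nil
  show ?case by (auto simp: poly_interp mult_def)
next
  case (snoc t xs)
  have "foldl (sketch_update n p) (r, \<lambda>v\<in>{..<n}. 0) (xs @ [t])
      = sketch_update n p (r, \<lambda>v\<in>{..<n}. poly (interp n (\<lambda>u. mult xs {u, v})) r mod p) t"
    by (simp only: foldl_append foldl.simps snoc)
  then show ?case
    unfolding sketch_update_def prod.case
    by (elim trans, intro arg_cong[where f = "Pair r"] restrict_ext)
      (simp add: poly_interp mult_snoc mod_add_left_eq distrib_right sum.distrib)
qed

section \<open>Matchings of the final graph\<close>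

lemma final_edges_valid:
  assumes "strict_turnstile n B xs" "e \<in> final_edges xs"
  shows "e \<subseteq> {..<n} \<and> card e = 2"
proof -
  have "filter (\<lambda>t. fst t = e) xs \<noteq> []" using assms(2) by (auto simp: final_edges_def mult_def)
  then obtain t where "t \<in> set xs" "fst t = e" by (auto simp: filter_empty_conv)
  then have "valid_edge n e" using assms(1) by (auto simp: strict_turnstile_def)
  then show ?thesis by (auto simp: valid_edge_def)
qed

lemma max_matching_eq_if_tight:
  assumes st: "strict_turnstile n B xs" and M: "is_matching (final_edges xs) M"
    and U: "U \<subseteq> {..<n}" "c ` ({..<n} - U) \<subseteq> {..<n}"
    and nocross: "\<And>u v. {u, v} \<in> final_edges xs \<Longrightarrow> u \<in> U \<or> v \<in> U \<or> c u = c v"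
    and tight: "card M = card U + (\<Sum>i<n. card {v \<in> {..<n} - U. c v = i} div 2)"
  shows "max_matching xs = card M"
  unfolding max_matching_def
proof (rule Max_eqI)
  have le: "card N \<le> card M" if "is_matching (final_edges xs) N" for N
    unfolding tight
  proof (rule matching_card_le_barrier[OF that finite_lessThan _ U(1) finite_lessThan U(2)])
    show "\<forall>e\<in>final_edges xs. e \<subseteq> {..<n} \<and> card e = 2"
      by (rule ballI) (rule final_edges_valid[OF st])
  qed (rule nocross)
  then show "finite {card N |N. is_matching (final_edges xs) N}"
    by (auto intro!: finite_subset[OF _ finite_atMost[of "card M"]])
  show "y \<le> card M" if "y \<in> {card N |N. is_matching (final_edges xs) N}" for y
    using that le by auto
  show "card M \<in> {card N |N. is_matching (final_edges xs) N}" using M by auto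
qed

section \<open>Matching certificates\<close>

text \<open>The map \<open>\<mu>\<close> comes from an untrusted prover. Only vertices whose mate
  points back count, so the mate edges are pairwise disjoint for every \<open>\<mu>\<close>.\<close>

definition mutual :: "nat \<Rightarrow> (nat \<Rightarrow> nat) \<Rightarrow> nat set" where
  "mutual n \<mu> = {u. u < n \<and> \<mu> u < n \<and> \<mu> u \<noteq> u \<and> \<mu> (\<mu> u) = u}"

definition mate_edges :: "nat \<Rightarrow> (nat \<Rightarrow> nat) \<Rightarrow> nat set set" where
  "mate_edges n \<mu> = (\<lambda>u. {u, \<mu> u}) ` mutual n \<mu>"

definition crossing :: "nat \<Rightarrow> (nat \<Rightarrow> nat) \<Rightarrow> nat \<Rightarrow> nat \<Rightarrow> int" where
  "crossing n c u v = of_bool (c u \<noteq> n \<and> c v \<noteq> n \<and> c u \<noteq> c v)"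

definition mates :: "(nat \<Rightarrow> nat) \<Rightarrow> nat \<Rightarrow> nat \<Rightarrow> int" where
  "mates \<mu> u v = of_bool (\<mu> u = v)"

text \<open>The label \<open>n\<close> marks the vertices of the barrier, and \<open>f\<^sub>1\<close>, \<open>f\<^sub>2\<close> stand for the weight polynomials
  of \<open>crossing\<close> and \<open>mates\<close>.\<close>
definition certifies :: "nat \<Rightarrow> int \<Rightarrow> (nat \<Rightarrow> nat) \<Rightarrow> (nat \<Rightarrow> nat) \<Rightarrow> int poly \<Rightarrow> int poly \<Rightarrow> bool" where
  "certifies n p c \<mu> f\<^sub>1 f\<^sub>2 \<longleftrightarrow> (\<forall>u<n. p dvd poly f\<^sub>1 (int u)) \<and> (\<forall>u\<in>mutual n \<mu>. \<not> p dvd poly f\<^sub>2 (int u)) \<and>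
    card (mate_edges n \<mu>) = card {v. v < n \<and> c v = n} + (\<Sum>i<n. card {v. v < n \<and> c v = i} div 2)"

text \<open>Transfers the certificate check between the prover's polynomials and the true weight
  polynomials.\<close>

lemma certifies_cong:
  assumes "\<And>u. u < n \<Longrightarrow> p dvd poly f\<^sub>1 (int u) - poly g\<^sub>1 (int u)"
    and "\<And>u. u < n \<Longrightarrow> p dvd poly f\<^sub>2 (int u) - poly g\<^sub>2 (int u)"
  shows "certifies n p c \<mu> f\<^sub>1 f\<^sub>2 \<longleftrightarrow> certifies n p c \<mu> g\<^sub>1 g\<^sub>2"
proof -
  have iff: "p dvd a \<longleftrightarrow> p dvd b" if "p dvd a - b" for a b
    using that dvd_add_right_iff[of p "a - b" b] by simp
  have "p dvd poly f\<^sub>1 (int u) \<longleftrightarrow> p dvd poly g\<^sub>1 (int u)" "p dvd poly f\<^sub>2 (int u) \<longleftrightarrow> p dvd poly g\<^sub>2 (int u)"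
    if "u < n" for u
    using iff assms that by blast+
  moreover have "u < n" if "u \<in> mutual n \<mu>" for u using that by (simp add: mutual_def)
  ultimately show ?thesis by (auto simp: certifies_def)
qed

abbreviation adj :: "token list \<Rightarrow> nat \<Rightarrow> nat \<Rightarrow> int" where
  "adj xs u v \<equiv> mult xs {u, v}"

lemma disjoint_mate_edges:
  assumes "e \<in> mate_edges n \<mu>" "f \<in> mate_edges n \<mu>" "e \<noteq> f"
  shows "e \<inter> f = {}"
  using assms by (auto simp: mate_edges_def mutual_def)

context
  fixes n B :: nat and p :: int and xs :: "token list"
  assumes st: "strict_turnstile n B xs" and p: "prime p" "int n \<le> p" "int (n * B) < p"
begin

text \<open>With weights 0 and 1 a row sum is at most \<open>n * B < p\<close>, so working modulo
  \<open>p\<close> loses nothing.\<close>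

lemma dvd_weight_poly_iff:
  assumes "u < n" "\<And>v. W u v \<in> {0, 1}"
  shows "p dvd poly (weight_poly n (adj xs) W) (int u) \<longleftrightarrow> (\<forall>v<n. W u v = 1 \<longrightarrow> {u, v} \<notin> final_edges xs)"
proof -
  have le: "0 \<le> adj xs u v * W u v \<and> adj xs u v * W u v \<le> int B" for v
    using st assms(2)[of v] by (auto simp: strict_turnstile_def)
  have "(\<Sum>v<n. adj xs u v * W u v) \<le> (\<Sum>v<n. int B)" using le by (intro sum_mono) blast
  then have "(\<Sum>v<n. adj xs u v * W u v) < p" using p(3) by simp
  then have "p dvd poly (weight_poly n (adj xs) W) (int u) \<longleftrightarrow> (\<forall>v<n. adj xs u v * W u v = 0)"
    using le by (intro dvd_weight_poly_node_iff[OF p(1,2) assms(1)]) auto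
  moreover have "adj xs u v * W u v = 0 \<longleftrightarrow> (W u v = 1 \<longrightarrow> {u, v} \<notin> final_edges xs)" for v
  proof -
    have "0 \<le> adj xs u v" using st by (simp add: strict_turnstile_def)
    then show ?thesis using assms(2)[of v] by (auto simp: final_edges_def)
  qed
  ultimately show ?thesis by simp
qed

lemma certifies_weight_polys_iff:
  "certifies n p c \<mu> (weight_poly n (adj xs) (crossing n c)) (weight_poly n (adj xs) (mates \<mu>)) \<longleftrightarrow>
    (\<forall>u<n. \<forall>v<n. {u, v} \<in> final_edges xs \<longrightarrow> c u = n \<or> c v = n \<or> c u = c v) \<and>
    mate_edges n \<mu> \<subseteq> final_edges xs \<and>
    card (mate_edges n \<mu>) = card {v. v < n \<and> c v = n} + (\<Sum>i<n. card {v. v < n \<and> c v = i} div 2)"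
proof -
  have "p dvd poly (weight_poly n (adj xs) (crossing n c)) (int u) \<longleftrightarrow>
      (\<forall>v<n. {u, v} \<in> final_edges xs \<longrightarrow> c u = n \<or> c v = n \<or> c u = c v)" if "u < n" for u
    by (subst dvd_weight_poly_iff[OF that]) (auto simp: crossing_def)
  \<comment> \<open>Row \<open>u\<close> of \<open>mates \<mu>\<close> has its only 1 in column
    \<open>\<mu> u\<close>.\<close>
  moreover have "p dvd poly (weight_poly n (adj xs) (mates \<mu>)) (int u) \<longleftrightarrow> {u, \<mu> u} \<notin> final_edges xs"
    if "u \<in> mutual n \<mu>" for u
    using that by (subst dvd_weight_poly_iff) (auto simp: mates_def mutual_def)
  ultimately show ?thesis by (auto simp: certifies_def mate_edges_def image_subset_iff)
qed

lemma max_matching_if_certifies: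
  assumes c: "c ` {..<n} \<subseteq> {..n}"
    and cert: "certifies n p c \<mu> (weight_poly n (adj xs) (crossing n c)) (weight_poly n (adj xs) (mates \<mu>))"
  shows "max_matching xs = card (mate_edges n \<mu>)"
proof (rule max_matching_eq_if_tight[OF st])
  define U where "U = {v. v < n \<and> c v = n}"
  note cert' = cert[unfolded certifies_weight_polys_iff]
  show "is_matching (final_edges xs) (mate_edges n \<mu>)"
    using cert' disjoint_mate_edges[of _ n \<mu>] unfolding is_matching_def by simp
  show "U \<subseteq> {..<n}" by (auto simp: U_def)
  show "c ` ({..<n} - U) \<subseteq> {..<n}" using c by (force simp: U_def)
  show "u \<in> U \<or> v \<in> U \<or> c u = c v" if "{u, v} \<in> final_edges xs" for u v
    using cert' that final_edges_valid[OF st that] by (auto simp: U_def)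
  have "{v \<in> {..<n} - U. c v = i} = {v. v < n \<and> c v = i}" if "i < n" for i
    using that by (auto simp: U_def)
  then show "card (mate_edges n \<mu>) = card U + (\<Sum>i<n. card {v \<in> {..<n} - U. c v = i} div 2)"
    using cert' by (simp add: U_def)
qed

lemma exists_certificate:
  "\<exists>c\<in>{..<n} \<rightarrow>\<^sub>E {..n}. \<exists>\<mu>\<in>{..<n} \<rightarrow>\<^sub>E {..n}.
    certifies n p c \<mu> (weight_poly n (adj xs) (crossing n c)) (weight_poly n (adj xs) (mates \<mu>))"
proof -
  let ?E = "final_edges xs"
  have E: "\<forall>e\<in>?E. e \<subseteq> {..<n} \<and> card e = 2" using final_edges_valid[OF st] by blast
  obtain U c' M where tb: "U \<subseteq> {..<n} \<and> c' ` ({..<n} - U) \<subseteq> {..<n} \<and>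
      (\<forall>u v. {u, v} \<in> ?E \<longrightarrow> u \<in> U \<or> v \<in> U \<or> c' u = c' v) \<and> is_matching ?E M \<and>
      card M = card U + (\<Sum>i<n. card {v \<in> {..<n} - U. c' v = i} div 2)"
    using exists_tight_barrier[OF finite_lessThan E] by (elim exE) (rule that)
  then have U: "U \<subseteq> {..<n}" "c' ` ({..<n} - U) \<subseteq> {..<n}"
    and nocross: "\<forall>u v. {u, v} \<in> ?E \<longrightarrow> u \<in> U \<or> v \<in> U \<or> c' u = c' v"
    and M: "M \<subseteq> ?E" "\<forall>e\<in>M. \<forall>f\<in>M. e \<noteq> f \<longrightarrow> e \<inter> f = {}"
    and tight: "card M = card U + (\<Sum>i<n. card {v \<in> {..<n} - U. c' v = i} div 2)"
    by (simp_all add: is_matching_def)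
  define c where "c = (\<lambda>v\<in>{..<n}. if v \<in> U then n else c' v)"
  \<comment> \<open>The out-of-range value \<open>n\<close> marks the vertices that \<open>M\<close>
    leaves uncovered.\<close>
  define \<mu> where "\<mu> = (\<lambda>v\<in>{..<n}. if \<exists>w. {v, w} \<in> M then (SOME w. {v, w} \<in> M) else n)"
  have ME: "u < n \<and> v < n \<and> u \<noteq> v" if "{u, v} \<in> M" for u v
  proof -
    have "{u, v} \<in> ?E" by (rule subsetD[OF M(1) that])
    then have "{u, v} \<subseteq> {..<n}" "card {u, v} = 2" using final_edges_valid[OF st] by blast+
    then show ?thesis by (cases "u = v") simp_all
  qed
  have mu: "\<mu> u = v" if uv: "{u, v} \<in> M" for u v
  proof -
    have "{u, SOME w. {u, w} \<in> M} \<in> M" by (rule someI[of "\<lambda>w. {u, w} \<in> M", OF uv])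
    then have "{u, SOME w. {u, w} \<in> M} = {u, v}"
      using M(2) uv by (metis Int_iff empty_iff insertI1)
    moreover have "\<mu> u = (SOME w. {u, w} \<in> M)" using uv ME[OF uv] by (simp add: \<mu>_def) (metis)
    ultimately show ?thesis using ME[OF uv] by (auto simp: doubleton_eq_iff)
  qed
  have mu_n: "\<mu> u = n" if "u < n" "\<nexists>v. {u, v} \<in> M" for u using that by (simp add: \<mu>_def)
  have "mate_edges n \<mu> = M"
  proof (intro equalityI subsetI)
    fix e assume "e \<in> mate_edges n \<mu>"
    then obtain u where u: "u \<in> mutual n \<mu>" "e = {u, \<mu> u}" by (auto simp: mate_edges_def)
    then obtain v where "{u, v} \<in> M" using mu_n[of u] by (auto simp: mutual_def)
    then show "e \<in> M" using mu u(2) by metis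
  next
    fix e assume e: "e \<in> M"
    then have "e \<in> ?E" by (rule subsetD[OF M(1)])
    then have "card e = 2" using E by simp
    then obtain u v where uv: "e = {u, v}" by (auto simp: card_2_iff)
    then have "\<mu> u = v" "\<mu> v = u" using mu[of u v] mu[of v u] e by (auto simp: insert_commute)
    then show "e \<in> mate_edges n \<mu>" using ME[of u v] e uv by (auto simp: mate_edges_def mutual_def)
  qed
  moreover have "{v. v < n \<and> c v = n} = U" using U by (auto simp: c_def image_subset_iff)
  moreover have "{v. v < n \<and> c v = i} = {v \<in> {..<n} - U. c' v = i}" if "i < n" for i
    using that by (auto simp: c_def)
  moreover have "c u = n \<or> c v = n \<or> c u = c v" if "{u, v} \<in> ?E" "u < n" "v < n" for u v
    using that nocross by (auto simp: c_def)
  ultimately have "certifies n p c \<mu> (weight_poly n (adj xs) (crossing n c)) (weight_poly n (adj xs) (mates \<mu>))"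
    unfolding certifies_weight_polys_iff using tight M(1) by simp
  moreover have "c \<in> {..<n} \<rightarrow>\<^sub>E {..n}" using U by (auto simp: c_def image_subset_iff less_imp_le)
  moreover have "\<mu> v \<le> n" if "v < n" for v
    using mu[of v] ME[of v] mu_n[OF that] by (cases "\<exists>w. {v, w} \<in> M") (auto simp: less_imp_le)
  then have "\<mu> \<in> {..<n} \<rightarrow>\<^sub>E {..n}" by (auto simp: \<mu>_def PiE_def)
  ultimately show ?thesis by blast
qed

end

section \<open>The verifier\<close>

text \<open>The condition \<open>certifies\<close> is decided from the message alone; the two sums
  are the values of the true weight polynomials at \<open>r\<close> modulo \<open>p\<close>,
  recovered from the sketch.\<close>

definition matching_test :: "nat \<Rightarrow> int \<Rightarrow> int \<times> (nat \<Rightarrow> int) \<Rightarrow>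
    (nat \<Rightarrow> nat) \<times> (nat \<Rightarrow> nat) \<times> (nat \<Rightarrow> int) \<times> (nat \<Rightarrow> int) \<Rightarrow> nat option" where
  "matching_test n p = (\<lambda>(r, s) (c, \<mu>, g\<^sub>1, g\<^sub>2).
    let f\<^sub>1 = coeff_poly (2 * n) g\<^sub>1; f\<^sub>2 = coeff_poly (2 * n) g\<^sub>2 in
    if certifies n p c \<mu> f\<^sub>1 f\<^sub>2 \<and>
       p dvd poly f\<^sub>1 r - (\<Sum>v<n. s v * poly (interp n (\<lambda>u. crossing n c u v)) r) \<and>
       p dvd poly f\<^sub>2 r - (\<Sum>v<n. s v * poly (interp n (\<lambda>u. mates \<mu> u v)) r)
    then Some (card (mate_edges n \<mu>)) else None)"

lemma dvd_diff_sketch_iff: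
  "p dvd y - (\<Sum>v<n. (\<lambda>v\<in>{..<n}. poly (interp n (\<lambda>u. A u v)) r mod p) v * poly (interp n (\<lambda>u. W u v)) r)
    \<longleftrightarrow> p dvd y - poly (weight_poly n A W) r" (is "p dvd y - ?s \<longleftrightarrow> _")
proof -
  have "?s mod p = poly (weight_poly n A W) r mod p"
    unfolding weight_poly_def poly_sum poly_mult
  proof (subst (1 2) mod_sum_eq[symmetric], rule arg_cong[where f = "\<lambda>x. x mod p"], rule sum.cong)
    show "(\<lambda>v\<in>{..<n}. poly (interp n (\<lambda>u. A u v)) r mod p) v * poly (interp n (\<lambda>u. W u v)) r mod p =
        poly (interp n (\<lambda>u. A u v)) r * poly (interp n (\<lambda>u. W u v)) r mod p" if "v \<in> {..<n}" for v
      using that by (simp add: mod_mult_left_eq)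
  qed simp
  then show ?thesis by (simp add: mod_eq_dvd_iff[symmetric])
qed

lemma matching_test_sketch:
  "matching_test n p (foldl (sketch_update n p) (r, \<lambda>v\<in>{..<n}. 0) xs) (c, \<mu>, g\<^sub>1, g\<^sub>2) =
    (if certifies n p c \<mu> (coeff_poly (2 * n) g\<^sub>1) (coeff_poly (2 * n) g\<^sub>2) \<and>
       p dvd poly (coeff_poly (2 * n) g\<^sub>1) r - poly (weight_poly n (adj xs) (crossing n c)) r \<and>
       p dvd poly (coeff_poly (2 * n) g\<^sub>2) r - poly (weight_poly n (adj xs) (mates \<mu>)) r
     then Some (card (mate_edges n \<mu>)) else None)"
  unfolding foldl_sketch_update matching_test_def Let_def prod.case
  using dvd_diff_sketch_iff[of p _ n "adj xs"] by (simp only:)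

definition certificates :: "nat \<Rightarrow> int \<Rightarrow>
    ((nat \<Rightarrow> nat) \<times> (nat \<Rightarrow> nat) \<times> (nat \<Rightarrow> int) \<times> (nat \<Rightarrow> int)) set" where
  "certificates n p = ({..<n} \<rightarrow>\<^sub>E {..n}) \<times> ({..<n} \<rightarrow>\<^sub>E {..n}) \<times>
     ({..<2 * n} \<rightarrow>\<^sub>E {0..<p}) \<times> ({..<2 * n} \<rightarrow>\<^sub>E {0..<p})"

text \<open>A certificate consists of \<open>2 * n\<close> labels and \<open>4 * n\<close>
  coefficients, each with at most \<open>p\<close> possible values.\<close>

lemma certificates_bound:
  assumes "n < p"
  shows "finite (certificates n (int p))" "card (certificates n (int p)) \<le> p ^ (6 * n)"
proof -
  show "finite (certificates n (int p))"
    unfolding certificates_def by (intro finite_cartesian_product finite_PiE) auto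
  have "card (certificates n (int p)) = (n + 1) ^ n * ((n + 1) ^ n * (p ^ (2 * n) * p ^ (2 * n)))"
    unfolding certificates_def by (simp add: card_cartesian_product card_PiE)
  also have "\<dots> \<le> p ^ n * (p ^ n * (p ^ (2 * n) * p ^ (2 * n)))"
    using assms by (intro mult_mono power_mono) auto
  also have "\<dots> = p ^ (6 * n)" by (simp add: power_add[symmetric])
  finally show "card (certificates n (int p)) \<le> p ^ (6 * n)" .
qed

context
  fixes n B :: nat and p :: int and xs :: "token list"
  assumes n: "n > 0" and st: "strict_turnstile n B xs" and p: "prime p" "int n \<le> p" "int (n * B) < p"
begin

lemma exists_accepted_certificate:
  "\<exists>w\<in>certificates n p. \<forall>r. matching_test n p (foldl (sketch_update n p) (r, \<lambda>v\<in>{..<n}. 0) xs) w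
     = Some (max_matching xs)"
proof -
  obtain c \<mu> where c: "c \<in> {..<n} \<rightarrow>\<^sub>E {..n}" and mu: "\<mu> \<in> {..<n} \<rightarrow>\<^sub>E {..n}"
    and cert: "certifies n p c \<mu> (weight_poly n (adj xs) (crossing n c)) (weight_poly n (adj xs) (mates \<mu>))"
    using exists_certificate[OF st p] by blast
  define g where "g W = (\<lambda>i\<in>{..<2 * n}. coeff (weight_poly n (adj xs) W) i mod p)" for W
  have g: "p dvd poly (coeff_poly (2 * n) (g W)) x - poly (weight_poly n (adj xs) W) x" for W x
    by (rule coeff_poly_mod_dvd[OF degree_weight_poly[OF n]]) (simp add: g_def)
  have "g W \<in> {..<2 * n} \<rightarrow>\<^sub>E {0..<p}" for W
    using prime_gt_0_int[OF p(1)] by (auto simp: g_def)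
  then have "(c, \<mu>, g (crossing n c), g (mates \<mu>)) \<in> certificates n p"
    using c mu by (simp add: certificates_def)
  moreover have "certifies n p c \<mu> (coeff_poly (2 * n) (g (crossing n c))) (coeff_poly (2 * n) (g (mates \<mu>)))"
    using certifies_cong[OF g g] cert by blast
  moreover have "max_matching xs = card (mate_edges n \<mu>)"
    using c by (intro max_matching_if_certifies[OF st p _ cert]) auto
  ultimately show ?thesis using g by (intro bexI) (auto simp: matching_test_sketch)
qed

text \<open>A wrong answer means that the check succeeds for the prover's polynomials but fails for
  the true ones, so one pair differs modulo \<open>p\<close>. Every bad \<open>r\<close> is a point
  where that pair agrees, and there are fewer than \<open>2 * n\<close> such points.\<close>

lemma card_wrongly_accepting:
  assumes "w \<in> certificates n p"
  shows "card {r \<in> {0..<p}. matching_test n p (foldl (sketch_update n p) (r, \<lambda>v\<in>{..<n}. 0) xs) w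
     \<notin> {Some (max_matching xs), None}} < 2 * n" (is "card ?bad < _")
proof (cases "?bad = {}")
  case True
  show ?thesis unfolding True using n by simp
next
  case False
  obtain c \<mu> g\<^sub>1 g\<^sub>2 where w: "w = (c, \<mu>, g\<^sub>1, g\<^sub>2)" by (cases w) auto
  have c: "c ` {..<n} \<subseteq> {..n}" using assms by (auto simp: w certificates_def)
  let ?f\<^sub>1 = "coeff_poly (2 * n) g\<^sub>1" and ?f\<^sub>2 = "coeff_poly (2 * n) g\<^sub>2"
  let ?F\<^sub>1 = "weight_poly n (adj xs) (crossing n c)" and ?F\<^sub>2 = "weight_poly n (adj xs) (mates \<mu>)"
  have cert: "certifies n p c \<mu> ?f\<^sub>1 ?f\<^sub>2" and wrong: "card (mate_edges n \<mu>) \<noteq> max_matching xs"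
    using False by (auto simp: w matching_test_sketch split: if_splits)
  have "\<not> certifies n p c \<mu> ?F\<^sub>1 ?F\<^sub>2" using max_matching_if_certifies[OF st p c] wrong by metis
  moreover have agree: "card {r \<in> {0..<p}. p dvd poly (coeff_poly (2 * n) g) r - poly (weight_poly n (adj xs) W) r} < 2 * n"
    if "\<not> p dvd poly (coeff_poly (2 * n) g) x - poly (weight_poly n (adj xs) W) x" for g W x
    using n by (intro card_agreements_mod_prime[OF p(1) _ _ that] degree_coeff_poly degree_weight_poly) auto
  ultimately have "(\<exists>x. \<not> p dvd poly ?f\<^sub>1 x - poly ?F\<^sub>1 x) \<or> (\<exists>x. \<not> p dvd poly ?f\<^sub>2 x - poly ?F\<^sub>2 x)"
    using cert certifies_cong[of n p ?f\<^sub>1 ?F\<^sub>1 ?f\<^sub>2 ?F\<^sub>2 c \<mu>] by blast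
  then have "card {r \<in> {0..<p}. p dvd poly ?f\<^sub>1 r - poly ?F\<^sub>1 r} < 2 * n \<or>
      card {r \<in> {0..<p}. p dvd poly ?f\<^sub>2 r - poly ?F\<^sub>2 r} < 2 * n"
    using agree by blast
  moreover have sub: "?bad \<subseteq> {r \<in> {0..<p}. p dvd poly ?f\<^sub>1 r - poly ?F\<^sub>1 r}"
    "?bad \<subseteq> {r \<in> {0..<p}. p dvd poly ?f\<^sub>2 r - poly ?F\<^sub>2 r}"
    by (auto simp: w matching_test_sketch split: if_splits)
  have fin: "finite {r \<in> {0..<p}. P r}" for P
    by (rule finite_subset[OF _ finite_atLeastLessThan_int[of 0 p]]) auto
  have "card ?bad \<le> card {r \<in> {0..<p}. p dvd poly ?f\<^sub>1 r - poly ?F\<^sub>1 r}"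
    "card ?bad \<le> card {r \<in> {0..<p}. p dvd poly ?f\<^sub>2 r - poly ?F\<^sub>2 r}"
    by (rule card_mono[OF fin sub(1)], rule card_mono[OF fin sub(2)])
  ultimately show ?thesis by linarith
qed

end

section \<open>Choice of parameters and total cost\<close>

text \<open>Residues cost \<open>b\<close> bits each: the sketch has \<open>n + 1\<close> of them
  and the certificate fits in \<open>6 * n\<close>. The assumption \<open>6 * n \<le> p\<close>
  turns fewer than \<open>2 * n\<close> bad points into error at most 1/3.\<close>

lemma exists_scheme_from_prime:
  assumes n: "n > 0" and m: "m > 0" and p: "prime p" "n * B < p" "6 * n \<le> p" "p \<le> 2 ^ b"
  shows "\<exists>h init step out. online_maxmatching_scheme n B m h init step out (6 * n * b)
    ((n + 1) * b + 6 * n * b) (1/3)"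
proof -
  let ?p = "int p" and ?z = "\<lambda>v\<in>{..<n}. 0 :: int"
  let ?Q = "{0..<?p} \<times> ({..<n} \<rightarrow>\<^sub>E {0..<?p})"
  let ?Q\<^sub>0 = "(\<lambda>r. (r, ?z)) ` {0..<?p}"
  have ip: "prime ?p" "int n \<le> ?p" "int (n * B) < ?p" using p by (simp_all only: prime_int_nat_transfer) auto
  have p0: "p > 0" using p(1) by (rule prime_gt_0_nat)
  have "\<forall>xs. \<exists>w. strict_turnstile n B xs \<longrightarrow> w \<in> certificates n ?p \<and>
      (\<forall>r. matching_test n ?p (foldl (sketch_update n ?p) (r, ?z) xs) w = Some (max_matching xs))"
    using exists_accepted_certificate[OF n _ ip] by blast
  from choice[OF this] obtain cert where cert: "\<And>xs. strict_turnstile n B xs \<Longrightarrow> cert xs \<in> certificates n ?p"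
      "\<And>xs r. strict_turnstile n B xs \<Longrightarrow>
        matching_test n ?p (foldl (sketch_update n ?p) (r, ?z) xs) (cert xs) = Some (max_matching xs)"
    by blast
  have inj: "inj_on (\<lambda>r. (r, ?z)) A" for A :: "int set" by (auto intro: inj_onI)
  show ?thesis
  proof (rule scheme_of_certificate_test[where Q = ?Q and Q\<^sub>0 = ?Q\<^sub>0 and C = "certificates n ?p"
        and upd = "sketch_update n ?p" and test = "matching_test n ?p" and cert = cert])
    show "finite ?Q" by (intro finite_cartesian_product finite_PiE) auto
    have "card ?Q = p ^ (n + 1)" by (simp add: card_cartesian_product card_PiE)
    also have "\<dots> \<le> (2 ^ b) ^ (n + 1)" using p(4) by (intro power_mono) auto
    finally show "card ?Q \<le> 2 ^ ((n + 1) * b)" by (simp only: power_mult[symmetric] mult.commute)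
    have "?z \<in> {..<n} \<rightarrow>\<^sub>E {0..<?p}" using p0 by (simp add: restrict_PiE_iff del: restrict_apply)
    then show "?Q\<^sub>0 \<subseteq> ?Q" by blast
    show "?Q\<^sub>0 \<noteq> {}" using p0 by simp
    show "sketch_update n ?p q t \<in> ?Q" if "q \<in> ?Q" for q t
      using that p0 by (cases q) (simp add: sketch_update_def restrict_PiE_iff)
    have "n < p" using p(3) n by linarith
    note cc = certificates_bound[OF this]
    show "finite (certificates n ?p)" by (rule cc)
    have "p ^ (6 * n) \<le> (2 ^ b) ^ (6 * n)" using p(4) by (intro power_mono) auto
    also have "\<dots> = 2 ^ (6 * n * b)" by (simp only: power_mult[symmetric] mult.commute)
    finally show "card (certificates n ?p) \<le> 2 ^ (6 * n * b)" using cc(2) by linarith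
    show "matching_test n ?p (foldl (sketch_update n ?p) q xs) (cert xs) = Some (max_matching xs)"
      if "strict_turnstile n B xs" "q \<in> ?Q\<^sub>0" for xs q
      using that cert(2) by auto
    show "real (card {q \<in> ?Q\<^sub>0. matching_test n ?p (foldl (sketch_update n ?p) q xs) w
        \<notin> {Some (max_matching xs), None}}) \<le> 1 / 3 * real (card ?Q\<^sub>0)"
      if st: "strict_turnstile n B xs" and w: "w \<in> certificates n ?p" for xs w
    proof -
      let ?bad = "{r \<in> {0..<?p}. matching_test n ?p (foldl (sketch_update n ?p) (r, ?z) xs) w
        \<notin> {Some (max_matching xs), None}}"
      have "{q \<in> ?Q\<^sub>0. matching_test n ?p (foldl (sketch_update n ?p) q xs) w
        \<notin> {Some (max_matching xs), None}} = (\<lambda>r. (r, ?z)) ` ?bad" by blast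
      moreover have "card ((\<lambda>r. (r, ?z)) ` ?bad) = card ?bad" by (rule card_image[OF inj])
      moreover have "card ?bad < 2 * n" by (rule card_wrongly_accepting[OF n st ip w])
      moreover have "card ?Q\<^sub>0 = p" by (simp add: card_image[OF inj])
      ultimately show ?thesis using p(3) by (simp only:)
    qed
  qed (use m cert(1) in auto)
qed

text \<open>Without a token there is no place for an annotation; the verifier simply answers
  0.\<close>

lemma exists_scheme_empty_stream:
  "\<exists>h init step out. online_maxmatching_scheme n B 0 h init step out 0 0 (1/3)"
proof -
  have "{card M |M. is_matching (final_edges []) M} = {0}"
    by (auto simp: is_matching_def final_edges_def mult_def)
  then have "max_matching [] = 0" by (simp add: max_matching_def)
  then have "online_maxmatching_scheme n B 0 (\<lambda>_. []) (return_pmf []) (\<lambda>_ _. return_pmf []) (\<lambda>_. Some 0) 0 0 (1/3)"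
    by (simp add: online_maxmatching_scheme_def space_bounded_def verdict_def honest_def)
  then show ?thesis by blast
qed

lemma exists_prime_of_logarithmic_length:
  fixes n k :: nat
  assumes "n \<ge> 2"
  shows "\<exists>p b. prime p \<and> 6 * n ^ (k + 1) < p \<and> p \<le> 2 ^ b \<and> real b \<le> real (4 * k + 20) * log 2 (real n)"
proof -
  \<comment> \<open>A prime above \<open>N\<close> exceeds both \<open>6 * n\<close> and, whenever
    \<open>B \<le> n ^ k\<close>, also \<open>n * B\<close>.\<close>
  define N where "N = 6 * n ^ (k + 1)"
  obtain p where p: "prime p" "N < p" "p \<le> 4 * N\<^sup>2 + 1"
    using exists_prime_between[of N] assms by (auto simp: N_def)
  define l where "l = nat \<lceil>log 2 (real n)\<rceil>"
  have log1: "1 \<le> log 2 (real n)" using assms by (simp add: le_log_iff)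
  have l: "real l \<le> log 2 (real n) + 1" "log 2 (real n) \<le> real l" using log1 unfolding l_def by linarith+
  have "real n = 2 powr log 2 (real n)" using assms by simp
  also have "\<dots> \<le> 2 powr real l" using l by (intro powr_mono) auto
  finally have nl: "n \<le> 2 ^ l" by (simp add: powr_realpow)
  have "N\<^sup>2 = 36 * n ^ (2 * k + 2)" by (simp add: N_def power_mult_distrib power_mult[symmetric] power2_eq_square power_add[symmetric] mult_2)
  moreover have "1 \<le> n ^ (2 * k + 2)" using assms by simp
  \<comment> \<open>The constant is \<open>4 * 36 + 1 = 145\<close>, which is at most
    \<open>2 ^ 8\<close> and so at most \<open>n ^ 8\<close>.\<close>
  ultimately have "4 * N\<^sup>2 + 1 \<le> 2 ^ 8 * n ^ (2 * k + 2)" by simp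
  also have "\<dots> \<le> n ^ 8 * n ^ (2 * k + 2)" using assms by (intro mult_right_mono power_mono) auto
  also have "\<dots> = n ^ (2 * k + 10)" by (simp only: power_add[symmetric]) (simp add: add.commute)
  also have "\<dots> \<le> (2 ^ l) ^ (2 * k + 10)" using nl by (intro power_mono) auto
  finally have "p \<le> 2 ^ (l * (2 * k + 10))" using p(3) by (simp only: power_mult[symmetric])
  moreover have "real (l * (2 * k + 10)) \<le> real (4 * k + 20) * log 2 (real n)"
  proof -
    \<comment> \<open>Rounding the logarithm up adds at most 1, which at most doubles it since
      \<open>n \<ge> 2\<close>.\<close>
    have "real l \<le> 2 * log 2 (real n)" using l log1 by linarith
    then have "real l * real (2 * k + 10) \<le> 2 * log 2 (real n) * real (2 * k + 10)"
      by (rule mult_right_mono) simp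
    then show ?thesis by (simp add: algebra_simps)
  qed
  ultimately show ?thesis using p(1,2) unfolding N_def by blast
qed

theorem theorem3p2:
  fixes k :: nat
  shows "\<exists>c::real. c > 0 \<and>
    (\<forall>n B m. 2 \<le> n \<longrightarrow> 1 \<le> B \<longrightarrow> B \<le> n ^ k \<longrightarrow>
      (\<exists>h init step out H S.
         online_maxmatching_scheme n B m h init step out H S (1/3) \<and>
         real (H + S) \<le> c * real B * real n * log 2 (real n)))"
proof (intro exI[of _ "14 * real (4 * k + 20)"] conjI allI impI)
  fix n B m :: nat
  assume n: "2 \<le> n" and B: "1 \<le> B" "B \<le> n ^ k"
  have log0: "0 \<le> log 2 (real n)" using n by simp
  show "\<exists>h init step out H S. online_maxmatching_scheme n B m h init step out H S (1/3) \<and>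
      real (H + S) \<le> 14 * real (4 * k + 20) * real B * real n * log 2 (real n)"
  proof (cases "m = 0")
    case True
    then obtain h init step out where "online_maxmatching_scheme n B m h init step out 0 0 (1/3)"
      using exists_scheme_empty_stream by blast
    moreover have "real (0 + 0) \<le> 14 * real (4 * k + 20) * real B * real n * log 2 (real n)"
      using log0 by simp
    ultimately show ?thesis by blast
  next
    case False
    obtain p b where p: "prime p" "6 * n ^ (k + 1) < p" "p \<le> 2 ^ b"
      and b: "real b \<le> real (4 * k + 20) * log 2 (real n)"
      using exists_prime_of_logarithmic_length[OF n] by blast
    have "n * B \<le> n * n ^ k" "n * 1 \<le> n * n ^ k" using B n by (intro mult_left_mono; simp)+
    then have "n * B < p" "6 * n \<le> p" using p(2) by (simp_all only: power_add power_one_right mult_ac)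
    then obtain h init step out where sch: "online_maxmatching_scheme n B m h init step out (6 * n * b)
        ((n + 1) * b + 6 * n * b) (1/3)"
      using exists_scheme_from_prime[OF _ _ p(1) _ _ p(3), of n m B] n False by auto
    \<comment> \<open>The help of \<open>6 * n\<close> residues is counted twice, as it is also
      stored; together with the sketch this gives \<open>13 * n + 1\<close>, the origin of the
      constant 14.\<close>
    have "real (6 * n * b + ((n + 1) * b + 6 * n * b)) = (13 * real n + 1) * real b"
      by (simp add: algebra_simps)
    also have "\<dots> \<le> (14 * real n) * real b" using n by (intro mult_right_mono) auto
    also have "\<dots> \<le> (14 * real n) * (real (4 * k + 20) * log 2 (real n))"
      using b by (intro mult_left_mono) auto
    also have "\<dots> \<le> real B * \<dots>"
      using B log0 mult_right_mono[of 1 "real B" "(14 * real n) * (real (4 * k + 20) * log 2 (real n))"] by simp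
    finally have "real (6 * n * b + ((n + 1) * b + 6 * n * b)) \<le>
        14 * real (4 * k + 20) * real B * real n * log 2 (real n)" by (simp only: mult_ac)
    with sch show ?thesis by blast
  qed
qed simp

end
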